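(* Let $\|\cdot\|$ be a compatible unitarily invariant norm with associated symmetric gauge function $\psi$. If $\{V_i\}_{i=1}^m\in\mathcal C(m,l,d)$, with analysis operator $V$, then $$e_2^\psi(V)\ge \psi\!\left(\left(\tfrac{d}{ml}+c_{m,l,d}\right)\mathbf e_l,\ \left(\tfrac{d}{ml}-c_{m,l,d}\right)\mathbf e_l\right).$$ If $\{V_i\}_{i=1}^m$ is a uniformly weighted projective rank-$l$ $(m,l,d)$-protocol such that for all $i\ne j$, $V_iV_j^*=c_{m,l,d}\,Q_{i,j}$ for unitary operators $Q_{i,j}$ on $\mathcal K$, then $\{V_i\}_{i=1}^m\in\mathcal C(m,l,d)$ and, with $V$ its analysis operator, $$e_2^\psi(V)= \psi\!\left(\left(\tfrac{d}{ml}+c_{m,l,d}\right)\mathbf e_l,\ \left(\tfrac{d}{ml}-c_{m,l,d}\right)\mathbf e_l\right).$$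
   Context: $\mathbb F$ is $\mathbb R$ or $\mathbb C$; $\mathcal H=\mathbb F^d$, $\mathcal K=\mathbb F^l$. Standing assumptions: $l<d<ml$. An $(m,l,d)$-protocol on $\mathcal H$ is a family $\{V_i\}_{i=1}^m$ of linear operators $V_i:\mathcal H\to\mathcal K$ with $\sum_{i=1}^m V_i^*V_i=I_d$. Its analysis operator is $V:\mathcal H\to\bigoplus_{i=1}^m\mathcal K$, $Vx=\bigoplus_{i=1}^m V_ix$. It is projective if for each $i$, $V_i^*V_i=w_iP_i$ with $P_i$ an orthogonal projection on $\mathcal H$ and weight $w_i>0$; uniformly weighted projective (u.w.p.) if in addition all $w_i$ are equal; rank-$l$ if $\operatorname{rank}(V_i^* )=l$ for all $i$. A compatible unitarily invariant norm is a sequence $\{\|\cdot\|_n\}_{n\in\mathbb N}$, with $\|\cdot\|_n$ a unitarily invariant norm on $M_n(\mathbb F)$, such that $\left\|\begin{pmatrix}X&0\\0&\mathbf 0_t\end{pmatrix}\right\|_{r+t}=\|X\|_r$ for all $r,t$ and $X\in M_r(\mathbb F)$, where $\mathbf 0_t$ is the $t\times t$ zero matrix. If $\psi_n$ is the associated symmetric gauge function ($\|A\|_n=\psi_n(s(A))$, $s(A)$ the vector of singular values), this is equivalent to $\psi_{r+t}(x,0_t)=\psi_r(x)$ for $x\in\mathbb R^r$; one writes $\|\cdot\|$ and $\psi$ for all orders. $\mathbf e_l=(1,\dots,1)\in\mathbb R^l$. For $\mathbb K\subseteq\{1,\dots,m\}$, the packet-lost operator $E_{\mathbb K}$ on $\bigoplus_{j=1}^m\mathcal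 K$ replaces $y_j$ by $0$ in $\bigoplus_j y_j$ for $j\in\mathbb K$ and leaves the other components unchanged. The worst-case reconstruction error for $p$ lost packets is $e_p^\psi(V)=\max\{\|V^*V-V^*E_{\mathbb K}V\|:\ \mathbb K\subseteq\{1,\dots,m\},\ |\mathbb K|=p\}$. Put $c_{m,l,d}=\sqrt{\frac{d}{(m-1)\,m\,l}\left(1-\frac{d}{ml}\right)}$. $\mathcal C(m,l,d)$ is the class of all u.w.p. rank-$l$ $(m,l,d)$-protocols $\{V_i\}_{i=1}^m$ such that $\max_{1\le i\ne j\le m}\operatorname{tr}(|V_iV_j^*|)\ge l\cdot c_{m,l,d}$, where $|A|=(A^*A)^{1/2}$. *)

theory Defs
  imports
    "HOL-Combinatorics.Permutations"
    "Jordan_Normal_Form.Schur_Decomposition"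
    "Jordan_Normal_Form.Char_Poly"
    "Jordan_Normal_Form.DL_Rank"
begin

text \<open>
  The scalar field is either the reals or the complex numbers. The class below has exactly these two
  models, up to isomorphism: the first axiom says that the field is spanned over the reals by
  1 and \<open>\<iota>\<close>, where \<open>\<iota>\<close> is either 0 or a square root of -1; the second one makes
  \<open>conjugate\<close> and \<open>norm\<close> the usual conjugation and modulus. (The partial order that is part of
  \<open>conjugatable_ordered_field\<close> is not used in the definitions below.)
\<close>

class real_or_complex = real_normed_field + conjugatable_ordered_field +
  assumes real_or_complex_span:
      "\<exists>\<iota>. (\<iota> = 0 \<or> \<iota> * \<iota> = - 1) \<and> (\<forall>x. \<exists>a b. x = scaleR a 1 + scaleR b \<iota>)"
    and mult_conjugate: "x * conjugate x = scaleR ((norm x)\<^sup>2) 1"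

instance real :: real_or_complex
  by intro_classes (auto simp: power2_eq_square)

instance complex :: real_or_complex
proof
  show "\<exists>\<iota>::complex. (\<iota> = 0 \<or> \<iota> * \<iota> = - 1) \<and> (\<forall>x. \<exists>a b. x = scaleR a 1 + scaleR b \<iota>)"
    by (rule exI[of _ \<i>]) (auto simp: complex_eq_iff)
  show "x * conjugate x = scaleR ((norm x)\<^sup>2) 1" for x :: complex
    by (simp add: complex_norm_square[symmetric] scaleR_conv_of_real)
qed

subsection \<open>Matrices\<close>

definition unitary_mat :: "nat \<Rightarrow> 'a::real_or_complex mat \<Rightarrow> bool" where
  "unitary_mat n U \<longleftrightarrow>
     U \<in> carrier_mat n n \<and> mat_adjoint U * U = 1\<^sub>m n \<and> U * mat_adjoint U = 1\<^sub>m n"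

definition orth_proj :: "nat \<Rightarrow> 'a::real_or_complex mat \<Rightarrow> bool" where
  "orth_proj n P \<longleftrightarrow> P \<in> carrier_mat n n \<and> mat_adjoint P = P \<and> P * P = P"

text \<open>Self-adjointness is required explicitly, as it is not implied by the second condition
  over the reals.\<close>
definition pos_semidef :: "nat \<Rightarrow> 'a::real_or_complex mat \<Rightarrow> bool" where
  "pos_semidef n A \<longleftrightarrow> A \<in> carrier_mat n n \<and> mat_adjoint A = A \<and>
     (\<forall>x \<in> carrier_vec n. \<exists>r\<ge>0. (A *\<^sub>v x) \<bullet>c x = of_real r)"

definition mat_abs :: "'a::real_or_complex mat \<Rightarrow> 'a mat" where
  "mat_abs A = (THE B. pos_semidef (dim_col A) B \<and> B * B = mat_adjoint A * A)"

definition mat_trace :: "'a::real_or_complex mat \<Rightarrow> 'a" where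
  "mat_trace A = (\<Sum>i<dim_row A. A $$ (i, i))"

text \<open>The trace of \<open>mat_abs A\<close> is a real scalar; it is read back as a real number.\<close>
definition trace_abs :: "'a::real_or_complex mat \<Rightarrow> real" where
  "trace_abs A = (THE r. of_real r = mat_trace (mat_abs A))"

text \<open>Singular values with multiplicity, in decreasing order: their squares are the
  eigenvalues of \<open>mat_adjoint A * A\<close>.\<close>
definition singular_values :: "'a::real_or_complex mat \<Rightarrow> real vec" where
  "singular_values A = (THE s. s \<in> carrier_vec (dim_col A) \<and>
     (\<forall>i < dim_col A. 0 \<le> s $ i) \<and>
     (\<forall>i j. i \<le> j \<longrightarrow> j < dim_col A \<longrightarrow> s $ j \<le> s $ i) \<and>
     char_poly (mat_adjoint A * A) = (\<Prod>i<dim_col A. [:- of_real ((s $ i)\<^sup>2), 1:]))"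

subsection \<open>Norms\<close>

definition unitarily_invariant_norm :: "nat \<Rightarrow> ('a::real_or_complex mat \<Rightarrow> real) \<Rightarrow> bool" where
  "unitarily_invariant_norm n N \<longleftrightarrow>
     (\<forall>A \<in> carrier_mat n n. 0 \<le> N A \<and> (N A = 0 \<longleftrightarrow> A = 0\<^sub>m n n)) \<and>
     (\<forall>A \<in> carrier_mat n n. \<forall>c. N (c \<cdot>\<^sub>m A) = norm c * N A) \<and>
     (\<forall>A \<in> carrier_mat n n. \<forall>B \<in> carrier_mat n n. N (A + B) \<le> N A + N B) \<and>
     (\<forall>A \<in> carrier_mat n n. \<forall>U W. unitary_mat n U \<longrightarrow> unitary_mat n W \<longrightarrow> N (U * A * W) = N A)"

definition compatible_ui_norm :: "(nat \<Rightarrow> 'a::real_or_complex mat \<Rightarrow> real) \<Rightarrow> bool" where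
  "compatible_ui_norm N \<longleftrightarrow>
     (\<forall>n>0. unitarily_invariant_norm n (N n)) \<and>
     (\<forall>r>0. \<forall>t. \<forall>X \<in> carrier_mat r r.
        N (r + t) (four_block_mat X (0\<^sub>m r t) (0\<^sub>m t r) (0\<^sub>m t t)) = N r X)"

definition symmetric_gauge :: "nat \<Rightarrow> (real vec \<Rightarrow> real) \<Rightarrow> bool" where
  "symmetric_gauge n \<psi> \<longleftrightarrow>
     (\<forall>x \<in> carrier_vec n. 0 \<le> \<psi> x \<and> (\<psi> x = 0 \<longleftrightarrow> x = 0\<^sub>v n)) \<and>
     (\<forall>x \<in> carrier_vec n. \<forall>c. \<psi> (c \<cdot>\<^sub>v x) = \<bar>c\<bar> * \<psi> x) \<and>
     (\<forall>x \<in> carrier_vec n. \<forall>y \<in> carrier_vec n. \<psi> (x + y) \<le> \<psi> x + \<psi> y) \<and>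
     (\<forall>x \<in> carrier_vec n. \<forall>p. p permutes {..<n} \<longrightarrow> \<psi> (vec n (\<lambda>i. x $ p i)) = \<psi> x) \<and>
     (\<forall>x \<in> carrier_vec n. \<forall>\<epsilon>. (\<forall>i<n. \<epsilon> i = 1 \<or> \<epsilon> i = - 1) \<longrightarrow>
        \<psi> (vec n (\<lambda>i. \<epsilon> i * x $ i)) = \<psi> x)"

definition associated_gauge ::
  "(nat \<Rightarrow> 'a::real_or_complex mat \<Rightarrow> real) \<Rightarrow> (nat \<Rightarrow> real vec \<Rightarrow> real) \<Rightarrow> bool" where
  "associated_gauge N \<psi> \<longleftrightarrow>
     (\<forall>n>0. symmetric_gauge n (\<psi> n) \<and> (\<forall>A \<in> carrier_mat n n. N n A = \<psi> n (singular_values A)))"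

subsection \<open>Protocols\<close>

text \<open>Operators between \<open>\<F>\<^sup>d\<close> and \<open>\<F>\<^sup>l\<close> are identified with their matrices; only the values
  \<open>V 1, \<dots>, V m\<close> of a family \<open>V\<close> are relevant.\<close>

definition protocol :: "nat \<Rightarrow> nat \<Rightarrow> nat \<Rightarrow> (nat \<Rightarrow> 'a::real_or_complex mat) \<Rightarrow> bool" where
  "protocol m l d V \<longleftrightarrow>
     (\<forall>i \<in> {1..m}. V i \<in> carrier_mat l d) \<and>
     mat d d (\<lambda>(r, c). \<Sum>i = 1..m. (mat_adjoint (V i) * V i) $$ (r, c)) = 1\<^sub>m d"

definition uw_projective :: "nat \<Rightarrow> nat \<Rightarrow> (nat \<Rightarrow> 'a::real_or_complex mat) \<Rightarrow> bool" where
  "uw_projective m d V \<longleftrightarrow>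
     (\<exists>w>0. \<forall>i \<in> {1..m}. \<exists>P. orth_proj d P \<and> mat_adjoint (V i) * V i = of_real w \<cdot>\<^sub>m P)"

definition uwp_rank_protocol ::
  "nat \<Rightarrow> nat \<Rightarrow> nat \<Rightarrow> (nat \<Rightarrow> 'a::real_or_complex mat) \<Rightarrow> bool" where
  "uwp_rank_protocol m l d V \<longleftrightarrow>
     protocol m l d V \<and> uw_projective m d V \<and>
     (\<forall>i \<in> {1..m}. vec_space.rank d (mat_adjoint (V i)) = l)"

text \<open>The direct sum of \<open>m\<close> copies of \<open>\<F>\<^sup>l\<close> is \<open>\<F>\<^bsup>m * l\<^esup>\<close>; the coordinates of the \<open>j\<close>-th
  summand (\<open>1 \<le> j \<le> m\<close>) are those with (zero-based) index from \<open>(j - 1) * l\<close> to \<open>j * l - 1\<close>.\<close>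

definition analysis_op ::
  "nat \<Rightarrow> nat \<Rightarrow> nat \<Rightarrow> (nat \<Rightarrow> 'a::real_or_complex mat) \<Rightarrow> 'a mat" where
  "analysis_op m l d V = mat (m * l) d (\<lambda>(r, c). V (Suc (r div l)) $$ (r mod l, c))"

definition packet_lost :: "nat \<Rightarrow> nat \<Rightarrow> nat set \<Rightarrow> 'a::real_or_complex mat" where
  "packet_lost m l K =
     mat (m * l) (m * l) (\<lambda>(r, c). if r = c \<and> Suc (r div l) \<notin> K then 1 else 0)"

definition worst_error ::
  "(nat \<Rightarrow> 'a::real_or_complex mat \<Rightarrow> real) \<Rightarrow> nat \<Rightarrow> nat \<Rightarrow> nat \<Rightarrow> nat \<Rightarrow> 'a mat \<Rightarrow> real" where
  "worst_error N p m l d W =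
     Max {N d (mat_adjoint W * W - mat_adjoint W * packet_lost m l K * W) | K.
            K \<subseteq> {1..m} \<and> card K = p}"

definition c_const :: "nat \<Rightarrow> nat \<Rightarrow> nat \<Rightarrow> real" where
  "c_const m l d =
     sqrt (real d / ((real m - 1) * real m * real l) * (1 - real d / (real m * real l)))"

definition protocol_class :: "nat \<Rightarrow> nat \<Rightarrow> nat \<Rightarrow> (nat \<Rightarrow> 'a::real_or_complex mat) set" where
  "protocol_class m l d = {V. uwp_rank_protocol m l d V \<and>
     Max {trace_abs (V i * mat_adjoint (V j)) | i j. i \<in> {1..m} \<and> j \<in> {1..m} \<and> i \<noteq> j}
       \<ge> real l * c_const m l d}"

end

theory Submission
  imports Defs
begin

text \<open>
  Full rank and uniform weights force \<open>V\<^sub>i V\<^sub>i\<^sup>* = w I\<close>, and taking traces gives \<open>w = d / (m l)\<close>.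
  Losing the packets \<open>i, j\<close> yields the error operator \<open>V\<^sub>i\<^sup>* V\<^sub>i + V\<^sub>j\<^sup>* V\<^sub>j\<close>, whose nonzero eigenvalues
  are those of the block Gram matrix with diagonal blocks \<open>w I\<close> and off-diagonal block
  \<open>A = V\<^sub>i V\<^sub>j\<^sup>*\<close>; these are \<open>w \<plusminus> \<sigma>\<^sub>k\<close> for the singular values \<open>\<sigma>\<^sub>k\<close> of \<open>A\<close>. Averaging over cyclic shifts
  inside the two blocks replaces every \<open>\<sigma>\<^sub>k\<close> by the mean \<open>tr |A| / l \<ge> c\<close> without increasing the
  gauge, and \<open>(w + c, w - c)\<close> is a convex combination of the resulting vector and its block swap.
  The scalar field is handled by embedding it into the complex numbers, where Hermitian matrices
  have real eigenvalues.
\<close>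

section \<open>Scalars\<close>

text \<open>The constant \<open>c_const\<close> comes from a second-moment count. The squared
  Frobenius norms of the blocks \<open>V i * mat_adjoint (V j)\<close> over all ordered pairs sum to
  the trace of the identity, d; the diagonal pairs contribute m l w^2 = d w, so the pairs with i
  \<noteq> j average to d (1 - w) / (m (m - 1)) = l c^2. Thus c is the root mean square of the
  singular values of the off-diagonal blocks, while membership in \<open>protocol_class\<close> asks
  one block to have mean singular value at least c. A mean is exactly what averaging over
  permutations of the spectrum can see, which is why the trace norm fits an arbitrary gauge. An
  obstacle shapes the first half: \<open>mat_abs\<close>, \<open>trace_abs\<close> and
  \<open>singular_values\<close> are definite descriptions, so existence and uniqueness come before
  any use. Spectra are then passed around only as products of linear factors of characteristic
  polynomials; these forget the order of the eigenvalues, to which a symmetric gauge is blind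
  anyway.\<close>

lemma mult_conjugate_of_real: "(x::'a::real_or_complex) * conjugate x = of_real ((norm x)\<^sup>2)"
  by (simp add: mult_conjugate scaleR_conv_of_real)

lemma conjugate_of_real [simp]: "conjugate (of_real r :: 'a::real_or_complex) = of_real r"
proof (cases "r = 0")
  case False
  have "of_real r * conjugate (of_real r) = (of_real r * of_real r :: 'a)"
    unfolding mult_conjugate_of_real by (simp add: power2_eq_square)
  with False show ?thesis by simp
qed simp

lemma conjugate_one_eq [simp]: "conjugate (1 :: 'a::real_or_complex) = 1"
  using conjugate_of_real[of 1] by simp

text \<open>The generator \<iota> goes to 0 or to the imaginary unit, whichever has the same square.
  Products and conjugates of a + b \<iota> depend only on that square and on
  \<open>conjugate \<iota> = - \<iota>\<close>, so they are preserved.\<close>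

lemma complex_embedding:
  "\<exists>\<phi> :: 'a::real_or_complex \<Rightarrow> complex. inj_comm_ring_hom \<phi> \<and>
    (\<forall>r. \<phi> (of_real r) = of_real r) \<and> (\<forall>x. \<phi> (conjugate x) = cnj (\<phi> x))"
proof -
  obtain \<iota> :: 'a where \<iota>: "\<iota> = 0 \<or> \<iota> * \<iota> = - 1" 
    and span': "\<And>x. \<exists>a b. x = scaleR a 1 + scaleR b \<iota>"
    using real_or_complex_span by blast
  have span: "\<exists>a b. x = of_real a + of_real b * \<iota>" for x :: 'a
    using span'[of x] by (simp add: scaleR_conv_of_real)
  define \<kappa> :: complex where "\<kappa> = (if \<iota> = 0 then 0 else \<i>)"
  \<comment> \<open>If \<iota> = 0, the coefficient b is arbitrary, so the map is built from its
    graph, which is shown to be total and functional.\<close>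
  define R where "R x z \<longleftrightarrow> (\<exists>a b. x = of_real a + of_real b * \<iota> \<and> z = of_real a + of_real b * \<kappa>)"
    for x z
  have \<iota>2: "\<iota> * \<iota> = of_real (if \<iota> = 0 then 0 else - 1)" using \<iota> by auto
  have \<kappa>2: "\<kappa> * \<kappa> = of_real (if \<iota> = 0 then 0 else - 1)" by (auto simp: \<kappa>_def)
  have c\<iota>: "conjugate \<iota> = - \<iota>"
  proof (cases "\<iota> = 0")
    case False
    with \<iota> have "\<iota> * \<iota> = - 1" by simp
    \<comment> \<open>With modulus one, \<open>mult_conjugate\<close> gives
      \<open>\<iota> * conjugate \<iota> = 1 = \<iota> * (- \<iota>)\<close>, and \<iota>
      cancels.\<close>
    then have "norm \<iota> * norm \<iota> = 1" by (metis norm_minus_cancel norm_mult norm_one)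
    then have "\<iota> * conjugate \<iota> = \<iota> * (- \<iota>)"
      using \<open>\<iota> * \<iota> = - 1\<close> by (simp add: mult_conjugate_of_real power2_eq_square)
    with False show ?thesis by (simp only: mult_cancel_left) simp
  qed simp
  have c\<kappa>: "cnj \<kappa> = - \<kappa>" by (simp add: \<kappa>_def)
  \<comment> \<open>Multiplication by the formal conjugate turns x and z into the same real number,
    a^2 + b^2 or (for \<iota> = 0) a^2. One direction, applied to a difference, makes
    \<open>R\<close> functional; the other makes \<open>\<phi>\<close> injective.\<close>
  have eq0: "x = 0 \<longleftrightarrow> z = 0" if R: "R x z" for x z
  proof -
    let ?s = "if \<iota> = 0 then 0 else - 1 :: real"
    obtain a b where x: "x = of_real a + of_real b * \<iota>" and z: "z = of_real a + of_real b * \<kappa>"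
      using R by (auto simp: R_def)
    have "x * (of_real a - of_real b * \<iota>) = of_real (a * a) - of_real (b * b) * (\<iota> * \<iota>)"
      by (simp add: x algebra_simps)
    then have 1: "x * (of_real a - of_real b * \<iota>) = of_real (a * a - b * b * ?s)"
      unfolding \<iota>2 by simp
    have "z * (of_real a - of_real b * \<kappa>) = of_real (a * a) - of_real (b * b) * (\<kappa> * \<kappa>)"
      by (simp add: z algebra_simps)
    then have 2: "z * (of_real a - of_real b * \<kappa>) = of_real (a * a - b * b * ?s)"
      unfolding \<kappa>2 by simp
    have 3: "a * a - b * b * ?s = 0 \<Longrightarrow> a = 0 \<and> (\<iota> = 0 \<or> b = 0)"
      using sum_squares_eq_zero_iff[of a b] by (auto split: if_splits)
    show ?thesis
    proof
      assume "x = 0"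
      then have "a * a - b * b * ?s = 0" using 1 by (metis mult_zero_left of_real_eq_0_iff)
      then show "z = 0" using 3 by (auto simp: z \<kappa>_def)
    next
      assume "z = 0"
      then have "a * a - b * b * ?s = 0" using 2 by (metis mult_zero_left of_real_eq_0_iff)
      then show "x = 0" using 3 by (auto simp: x)
    qed
  qed
  have ex: "\<exists>z. R x z" for x using span[of x] by (auto simp: R_def)
  have add: "R (x + y) (z + w)" if "R x z" "R y w" for x y z w
  proof -
    obtain a b a' b' where "x = of_real a + of_real b * \<iota>" "z = of_real a + of_real b * \<kappa>"
       "y = of_real a' + of_real b' * \<iota>" "w = of_real a' + of_real b' * \<kappa>"
      using \<open>R x z\<close> \<open>R y w\<close> by (auto simp: R_def)
    then show ?thesis unfolding R_def
      by (intro exI[of _ "a + a'"] exI[of _ "b + b'"]) (simp add: algebra_simps)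
  qed
  have neg: "R (- x) (- z)" if "R x z" for x z
  proof -
    obtain a b where "x = of_real a + of_real b * \<iota>" "z = of_real a + of_real b * \<kappa>"
      using \<open>R x z\<close> by (auto simp: R_def)
    then show ?thesis unfolding R_def
      by (intro exI[of _ "- a"] exI[of _ "- b"]) (simp add: algebra_simps)
  qed
  have conj: "R (conjugate x) (cnj z)" if "R x z" for x z
  proof -
    obtain a b where "x = of_real a + of_real b * \<iota>" "z = of_real a + of_real b * \<kappa>"
      using \<open>R x z\<close> by (auto simp: R_def)
    then show ?thesis unfolding R_def
      by (intro exI[of _ "a"] exI[of _ "- b"])
        (simp add: conjugate_dist_add conjugate_dist_mul c\<iota> c\<kappa>)
  qed
  have mul: "R (x * y) (z * w)" if "R x z" "R y w" for x y z w
  proof -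
    let ?s = "if \<iota> = 0 then 0 else - 1 :: real"
    obtain a b a' b' where *: "x = of_real a + of_real b * \<iota>" "z = of_real a + of_real b * \<kappa>"
       "y = of_real a' + of_real b' * \<iota>" "w = of_real a' + of_real b' * \<kappa>"
      using \<open>R x z\<close> \<open>R y w\<close> by (auto simp: R_def)
    have "x * y = of_real (a * a') + of_real (b * b') * (\<iota> * \<iota>) + of_real (a * b' + a' * b) * \<iota>"
      by (simp add: * algebra_simps)
    moreover have "z * w = of_real (a * a') + of_real (b * b') * (\<kappa> * \<kappa>) + of_real (a * b' + a' * b) * \<kappa>"
      by (simp add: * algebra_simps)
    ultimately show ?thesis unfolding R_def \<iota>2 \<kappa>2
      by (intro exI[of _ "a * a' + b * b' * ?s"] exI[of _ "a * b' + a' * b"]) simp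
  qed
  have real: "R (of_real r) (of_real r)" for r
    unfolding R_def by (intro exI[of _ r] exI[of _ 0]) simp
  have unique: "z = w" if "R x z" "R x w" for x z w
    using eq0[OF add[OF that(1) neg[OF that(2)]]] by simp
  define \<phi> where "\<phi> x = (THE z. R x z)" for x
  have R\<phi>: "R x (\<phi> x)" for x unfolding \<phi>_def by (rule theI') (use ex unique in blast)
  have \<phi>: "\<phi> x = z" if "R x z" for x z using unique[OF R\<phi> that] .
  show ?thesis
  proof (intro exI[of _ \<phi>] conjI allI)
    show "inj_comm_ring_hom \<phi>"
    proof
      show "\<phi> 0 = 0" "\<phi> 1 = 1" using \<phi>[OF real[of 0]] \<phi>[OF real[of 1]] by simp_all
      show "\<phi> (x + y) = \<phi> x + \<phi> y" "\<phi> (x * y) = \<phi> x * \<phi> y" for x y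
        by (intro \<phi> add mul R\<phi>)+
      show "x = 0" if "\<phi> x = 0" for x using eq0[OF R\<phi>[of x]] that by simp
    qed
  qed (intro \<phi> real conj R\<phi>)+
qed

section \<open>Adjoints and the spectral theorem\<close>

lemma mat_adjoint_alt:
  "mat_adjoint A = mat (dim_col A) (dim_row A) (\<lambda>(i, j). conjugate (A $$ (j, i)))"
  by (rule eq_matI) (auto simp: mat_adjoint_def mat_of_rows_index)

lemma mat_adjoint_dim [simp]:
  "dim_row (mat_adjoint A) = dim_col A" "dim_col (mat_adjoint A) = dim_row A"
  by (simp_all add: mat_adjoint_alt)

lemma mat_adjoint_carrier [simp, intro]: "A \<in> carrier_mat n k \<Longrightarrow> mat_adjoint A \<in> carrier_mat k n"
  by auto

lemma mat_adjoint_index [simp]: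
  "i < dim_col A \<Longrightarrow> j < dim_row A \<Longrightarrow> mat_adjoint A $$ (i, j) = conjugate (A $$ (j, i))"
  by (simp add: mat_adjoint_alt)

lemma mat_adjoint_adjoint [simp]: "mat_adjoint (mat_adjoint A) = A"
  by (rule eq_matI) auto

lemma mat_adjoint_one [simp]: "mat_adjoint (1\<^sub>m n :: 'a::real_or_complex mat) = 1\<^sub>m n"
  by (rule eq_matI) auto

lemma mat_adjoint_zero [simp]: "mat_adjoint (0\<^sub>m n k) = (0\<^sub>m k n :: 'a::real_or_complex mat)"
  by (rule eq_matI) auto

lemma mat_adjoint_mult:
  fixes A B :: "'a::conjugatable_field mat"
  assumes "A \<in> carrier_mat n k" "B \<in> carrier_mat k p"
  shows "mat_adjoint (A * B) = mat_adjoint B * mat_adjoint A"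
  using assms
  by (intro eq_matI) (auto simp: scalar_prod_def sum_conjugate conjugate_dist_mul mult.commute
      intro!: sum.cong)

lemma mat_adjoint_smult:
  "mat_adjoint (c \<cdot>\<^sub>m A) = conjugate c \<cdot>\<^sub>m mat_adjoint (A :: 'a::conjugatable_field mat)"
  by (intro eq_matI) (auto simp: conjugate_dist_mul)

lemma mat_adjoint_four_block:
  assumes "A \<in> carrier_mat n1 k1" "B \<in> carrier_mat n1 k2" "C \<in> carrier_mat n2 k1" "D \<in> carrier_mat n2 k2"
  shows "mat_adjoint (four_block_mat A B C D) =
    four_block_mat (mat_adjoint A) (mat_adjoint C) (mat_adjoint B) (mat_adjoint D)"
  using assms by (intro eq_matI) auto

lemma cscalar_prod_adjoint:
  fixes A :: "'a::conjugatable_field mat"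
  assumes "A \<in> carrier_mat n k" "v \<in> carrier_vec k" "w \<in> carrier_vec n"
  shows "(A *\<^sub>v v) \<bullet>c w = v \<bullet>c (mat_adjoint A *\<^sub>v w)"
proof -
  have "(A *\<^sub>v v) \<bullet>c w = (\<Sum>i<n. \<Sum>j<k. A $$ (i, j) * v $ j * conjugate (w $ i))"
    using assms by (auto simp: scalar_prod_def sum_distrib_right lessThan_atLeast0 intro!: sum.cong)
  also have "\<dots> = (\<Sum>j<k. \<Sum>i<n. A $$ (i, j) * v $ j * conjugate (w $ i))" by (rule sum.swap)
  also have "\<dots> = v \<bullet>c (mat_adjoint A *\<^sub>v w)"
    using assms by (auto simp: scalar_prod_def sum_distrib_left lessThan_atLeast0 sum_conjugate
        conjugate_dist_mul ac_simps intro!: sum.cong)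
  finally show ?thesis .
qed

lemma cscalar_prod_self:
  fixes v :: "'a::real_or_complex vec"
  shows "v \<bullet>c v = of_real (\<Sum>i<dim_vec v. (norm (v $ i))\<^sup>2)"
  by (auto simp: scalar_prod_def mult_conjugate_of_real lessThan_atLeast0 intro!: sum.cong)

section \<open>Real eigenvalues and unitary diagonalization\<close>

text \<open>A complex root of the characteristic polynomial of the embedded matrix is real, hence
  the image of some \<open>of_real r\<close>. Injectivity of \<open>\<phi>\<close> pulls the root
  back, so the eigenvector exists over the original field.\<close>

lemma hermitian_eigenvector:
  fixes A :: "'a::real_or_complex mat"
  assumes A: "A \<in> carrier_mat n n" and herm: "mat_adjoint A = A" and n: "n > 0"
  obtains r v where "eigenvector A v (of_real r)"
proof -
  obtain \<phi> :: "'a \<Rightarrow> complex" where inj: "inj_comm_ring_hom \<phi>"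
    and real: "\<And>r. \<phi> (of_real r) = of_real r" and cnj: "\<And>x. \<phi> (conjugate x) = cnj (\<phi> x)"
    using complex_embedding by blast
  interpret inj_comm_ring_hom \<phi> by (rule inj)
  define B where "B = map_mat \<phi> A"
  have B: "B \<in> carrier_mat n n" using A by (simp add: B_def)
  have hB: "mat_adjoint B = B"
    using herm A unfolding B_def
    by (intro eq_matI) (auto simp flip: cnj, metis carrier_matD mat_adjoint_index)
  obtain as where as: "char_poly B = (\<Prod>a\<leftarrow>as. [:- a, 1:])" "length as = n"
    using char_poly_factorized[OF B] by blast
  then obtain e es where "as = e # es" using n by (cases as) auto
  then have root: "poly (char_poly B) e = 0" using as by simp
  then obtain u where u: "eigenvector B u e"
    using eigenvalue_root_char_poly[OF B] by (auto simp: eigenvalue_def)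
  then have u': "u \<in> carrier_vec n" "u \<noteq> 0\<^sub>v n" "B *\<^sub>v u = e \<cdot>\<^sub>v u"
    using B by (auto simp: eigenvector_def)
  \<comment> \<open>Moving \<open>B\<close> across the inner product gives e = cnj e.\<close>
  have "e * (u \<bullet>c u) = (B *\<^sub>v u) \<bullet>c u" using u' by simp
  also have "\<dots> = u \<bullet>c (B *\<^sub>v u)" using cscalar_prod_adjoint[OF B u'(1) u'(1)] hB by simp
  also have "\<dots> = cnj e * (u \<bullet>c u)" using u' by (simp add: conjugate_smult_vec)
  finally have "e = cnj e" using u' by simp
  then obtain r where r: "e = of_real r" by (metis Reals_cases Reals_cnj_iff)
  have "\<phi> (poly (char_poly A) (of_real r)) = poly (map_poly \<phi> (char_poly A)) (\<phi> (of_real r))"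
    by simp
  also have "\<dots> = 0" using root char_poly_hom[OF A] by (simp add: r real B_def)
  finally have "eigenvalue A (of_real r)"
    by (simp add: eigenvalue_root_char_poly[OF A])
  then show ?thesis using that by (auto simp: eigenvalue_def)
qed

text \<open>Eigenvalues are kept as real numbers and coerced only inside the matrix, so that they
  can be ordered, have square roots and be handed to a gauge over either field.\<close>

definition real_diag :: "nat \<Rightarrow> (nat \<Rightarrow> real) \<Rightarrow> 'a::real_or_complex mat" where
  "real_diag n e = mat n n (\<lambda>(i, j). if i = j then of_real (e i) else 0)"

lemma real_diag_carrier [simp]: "real_diag n e \<in> carrier_mat n n"
  and real_diag_dim [simp]: "dim_row (real_diag n e) = n" "dim_col (real_diag n e) = n"
  and real_diag_index [simp]: "i < n \<Longrightarrow> j < n \<Longrightarrow>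
    real_diag n e $$ (i, j) = (if i = j then of_real (e i) else 0)"
  by (simp_all add: real_diag_def)

lemma real_diag_adjoint [simp]: "mat_adjoint (real_diag n e) = real_diag n e"
  by (rule eq_matI) auto

lemma real_diag_mult: "real_diag n e * real_diag n f = real_diag n (\<lambda>i. e i * f i)"
proof (rule eq_matI, goal_cases)
  case (1 i j)
  then have "(real_diag n e * real_diag n f) $$ (i, j) =
      (\<Sum>k\<in>{0..<n}. if k = i then of_real (e i) * real_diag n f $$ (i, j) else 0 :: 'a)"
    by (simp add: scalar_prod_def if_distrib[of "\<lambda>x. x * _"] cong: if_cong)
  with 1 show ?case by simp
qed auto

lemma char_poly_real_diag:
  "char_poly (real_diag n e :: 'a::real_or_complex mat) = (\<Prod>i<n. [:- of_real (e i), 1:])"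
proof -
  have "upper_triangular (real_diag n e :: 'a mat)" by (auto simp: upper_triangular_def)
  from char_poly_upper_triangular[OF _ this, of n]
  show ?thesis
    by (auto simp: diag_mat_def prod.list_conv_set_nth lessThan_atLeast0 intro!: prod.cong)
qed

lemma unitary_matD:
  assumes "unitary_mat n U"
  shows "U \<in> carrier_mat n n" "mat_adjoint U \<in> carrier_mat n n"
    "mat_adjoint U * U = 1\<^sub>m n" "U * mat_adjoint U = 1\<^sub>m n"
  using assms by (auto simp: unitary_mat_def)

lemma unitary_matI:
  assumes U: "U \<in> carrier_mat n n" and one: "mat_adjoint U * U = 1\<^sub>m n"
  shows "unitary_mat n U"
  using mat_mult_left_right_inverse[OF _ U one] assms by (auto simp: unitary_mat_def)

lemma unitary_mat_mult:
  assumes U: "unitary_mat n U" and W: "unitary_mat n W"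
  shows "unitary_mat n (U * W)"
proof (rule unitary_matI)
  note c = unitary_matD[OF U] unitary_matD[OF W]
  show "U * W \<in> carrier_mat n n" using c by simp
  have "mat_adjoint (U * W) * (U * W) = mat_adjoint W * (mat_adjoint U * U) * W"
    using c(1,2,5,6) by (simp add: mat_adjoint_mult[OF c(1) c(5)] assoc_mult_mat[of _ n n _ n _ n]
      mult_carrier_mat[of _ n n _ n])
  also have "\<dots> = 1\<^sub>m n" using c by simp
  finally show "mat_adjoint (U * W) * (U * W) = 1\<^sub>m n" .
qed

lemma unitary_four_block:
  assumes U: "unitary_mat n U" and W: "unitary_mat k W"
  shows "unitary_mat (n + k) (four_block_mat U (0\<^sub>m n k) (0\<^sub>m k n) W)"
proof (rule unitary_matI)
  note c = unitary_matD[OF U] unitary_matD[OF W]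
  show "four_block_mat U (0\<^sub>m n k) (0\<^sub>m k n) W \<in> carrier_mat (n + k) (n + k)" using c by simp
  show "mat_adjoint (four_block_mat U (0\<^sub>m n k) (0\<^sub>m k n) W) * four_block_mat U (0\<^sub>m n k) (0\<^sub>m k n) W
      = 1\<^sub>m (n + k)"
    using c by (simp add: mat_adjoint_four_block[of _ n n _ k _ k]
      mult_four_block_mat[of _ n n _ k _ k _ _ n _ k])
qed

text \<open>Gram-Schmidt on a basis that starts with \<open>v\<close> keeps \<open>v\<close> in
  front and leaves the columns orthogonal but not normalized. Column j is then rescaled by
  \<open>s j\<close>, the inverse of its length, which is a real number in both fields.\<close>

lemma unitary_with_first_col:
  fixes v :: "'a::real_or_complex vec"
  assumes v: "v \<in> carrier_vec n" "v \<noteq> 0\<^sub>v n" and n: "n > 0"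
  shows "\<exists>U c. unitary_mat n U \<and> c \<noteq> 0 \<and> col U 0 = c \<cdot>\<^sub>v v"
proof -
  interpret cof_vec_space n "TYPE('a)" .
  define b where "b = basis_completion v"
  define ws where "ws = gram_schmidt n b"
  from basis_completion[OF v, folded b_def]
  have b: "distinct b" "\<not> lin_dep (set b)" "set b \<subseteq> carrier_vec n" "hd b = v" "length b = n"
    by auto
  with n obtain vs where bv: "b = v # vs" by (cases b) auto
  from gram_schmidt_result[OF b(3,1,2) refl, folded ws_def] b(5)
  have ws: "set ws \<subseteq> carrier_vec n" "corthogonal ws" "length ws = n" by auto
  from gram_schmidt_hd[OF v(1), of vs, folded bv] have "hd ws = v" unfolding ws_def .
  then have ws0: "ws ! 0 = v" using n ws(3) by (cases ws) auto
  define q where "q j = (\<Sum>i<n. (norm (ws ! j $ i))\<^sup>2)" for j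
  have wsc: "ws ! j \<in> carrier_vec n" if "j < n" for j using ws that by auto
  have q: "ws ! j \<bullet>c ws ! j = of_real (q j)" if "j < n" for j
    using wsc[OF that] cscalar_prod_self[of "ws ! j"] by (simp add: q_def)
  have qpos: "q j > 0" if "j < n" for j
  proof -
    have "ws ! j \<bullet>c ws ! j \<noteq> 0" using corthogonalD[OF ws(2), of j j] ws(3) that by auto
    then have "q j \<noteq> 0" using q[OF that] by auto
    moreover have "q j \<ge> 0" by (simp add: q_def sum_nonneg)
    ultimately show ?thesis by simp
  qed
  define s where "s j = 1 / sqrt (q j)" for j
  define U where "U = mat n n (\<lambda>(i, j). of_real (s j) * ws ! j $ i)"
  have "mat_adjoint U * U = 1\<^sub>m n"
  proof (rule eq_matI, goal_cases)
    case (1 i j)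
    then have ij: "i < n" "j < n" by auto
    have "(mat_adjoint U * U) $$ (i, j) = of_real (s i * s j) * (ws ! j \<bullet>c ws ! i)"
      using ij wsc[of i] wsc[of j]
      by (auto simp: U_def scalar_prod_def sum_distrib_left conjugate_dist_mul ac_simps intro!: sum.cong)
    also have "\<dots> = 1\<^sub>m n $$ (i, j)"
    proof (cases "i = j")
      case True
      have "s j * s j * q j = 1" using qpos[OF ij(2)] by (simp add: s_def field_simps)
      then have "of_real (s j * s j) * of_real (q j) = (1::'a)" by (metis of_real_mult of_real_1)
      then show ?thesis using True ij q by simp
    next
      case False
      then show ?thesis using corthogonalD[OF ws(2), of j i] ws(3) ij by auto
    qed
    finally show ?case .
  qed (auto simp: U_def)
  then have "unitary_mat n U" by (intro unitary_matI) (auto simp: U_def)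
  moreover have "col U 0 = of_real (s 0) \<cdot>\<^sub>v v"
    using n v(1) by (auto simp: U_def ws0[symmetric])
  moreover have "s 0 \<noteq> 0" using qpos[OF n] by (simp add: s_def)
  ultimately show ?thesis by (metis of_real_eq_0_iff)
qed

text \<open>Deflation: after conjugation by a unitary \<open>W\<close> whose first column is an
  eigenvector, the first column of \<open>B\<close> is r times a unit vector. Self-adjointness gives
  the first row the same shape, and the remaining block \<open>C\<close> falls under the induction
  hypothesis.\<close>

theorem hermitian_spectral:
  fixes A :: "'a::real_or_complex mat"
  assumes "A \<in> carrier_mat n n" and "mat_adjoint A = A"
  shows "\<exists>U e. unitary_mat n U \<and> A = U * real_diag n e * mat_adjoint U"
  using assms
proof (induction n arbitrary: A)
  case 0
  then show ?case
    by (intro exI[of _ "1\<^sub>m 0"] exI[of _ "\<lambda>_. 0"]) (auto simp: unitary_mat_def)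
next
  case (Suc n)
  note A = Suc.prems
  obtain r v where "eigenvector A v (of_real r)" using hermitian_eigenvector[OF A] by blast
  then have v: "v \<in> carrier_vec (Suc n)" "v \<noteq> 0\<^sub>v (Suc n)" "A *\<^sub>v v = of_real r \<cdot>\<^sub>v v"
    using A by (auto simp: eigenvector_def)
  obtain W c where W: "unitary_mat (Suc n) W" and c: "c \<noteq> 0" "col W 0 = c \<cdot>\<^sub>v v"
    using unitary_with_first_col[OF v(1,2)] by auto
  note Wc = unitary_matD[OF W]
  define B where "B = mat_adjoint W * A * W"
  have B: "B \<in> carrier_mat (Suc n) (Suc n)" using A Wc
    by (simp add: B_def mult_carrier_mat[of _ "Suc n" "Suc n" _ "Suc n"])
  have hB: "mat_adjoint B = B"
    using A Wc by (simp add: B_def mat_adjoint_mult[of _ "Suc n" "Suc n" _ "Suc n"]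
      assoc_mult_mat[of _ "Suc n" "Suc n" _ "Suc n" _ "Suc n"])
  have AW: "A * W \<in> carrier_mat (Suc n) (Suc n)" using A(1) Wc(1) by (rule mult_carrier_mat)
  have "B = mat_adjoint W * (A * W)" unfolding B_def using Wc(2) A(1) Wc(1) by (rule assoc_mult_mat)
  then have "col B 0 = mat_adjoint W *\<^sub>v (A *\<^sub>v (col W 0))"
    by (simp only: col_mult2[OF Wc(2) AW zero_less_Suc] col_mult2[OF A(1) Wc(1) zero_less_Suc])
  also have "A *\<^sub>v (col W 0) = of_real r \<cdot>\<^sub>v col W 0"
    unfolding c(2) using v A
    by (simp add: mult_mat_vec[of _ "Suc n" "Suc n"] smult_smult_assoc mult.commute)
  also have "mat_adjoint W *\<^sub>v (of_real r \<cdot>\<^sub>v col W 0) = of_real r \<cdot>\<^sub>v col (mat_adjoint W * W) 0"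
    using Wc(1,2) mult_mat_vec[OF Wc(2), of "col W 0"] col_mult2[OF Wc(2,1), of 0] by auto
  finally have colB: "col B 0 = of_real r \<cdot>\<^sub>v unit_vec (Suc n) 0" using Wc by simp
  have B0: "B $$ (i, 0) = (if i = 0 then of_real r else 0)" if "i < Suc n" for i
    using arg_cong[OF colB, of "\<lambda>v. v $ i"] that B by (simp split: if_splits)
  have B0': "B $$ (0, i) = (if i = 0 then of_real r else 0)" if "i < Suc n" for i
    using B0[OF that] that B by (subst hB[symmetric]) (auto simp del: hB)
  define C where "C = mat n n (\<lambda>(i, j). B $$ (Suc i, Suc j))"
  have C: "C \<in> carrier_mat n n" by (simp add: C_def)
  have hC: "mat_adjoint C = C"
  proof (rule eq_matI, goal_cases)
    case (1 i j)
    then show ?case using B arg_cong[OF hB, of "\<lambda>M. M $$ (Suc i, Suc j)"] by (auto simp: C_def)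
  qed (auto simp: C_def)
  obtain U e where U: "unitary_mat n U" and Ce: "C = U * real_diag n e * mat_adjoint U"
    using Suc.IH[OF C hC] by blast
  note Uc = unitary_matD[OF U]
  define U' where "U' = four_block_mat (1\<^sub>m 1) (0\<^sub>m 1 n) (0\<^sub>m n 1) U"
  \<comment> \<open>The split-off eigenvalue sits at index 0, the others move up by one.\<close>
  define e' where "e' = case_nat r e"
  have U': "unitary_mat (Suc n) U'"
    using unitary_four_block[of 1 "1\<^sub>m 1" n U] U by (simp add: U'_def unitary_mat_def)
  note U'c = unitary_matD[OF U']
  have diag: "real_diag (Suc n) e' = four_block_mat (real_diag 1 (\<lambda>_. r)) (0\<^sub>m 1 n) (0\<^sub>m n 1) (real_diag n e)"
    by (rule eq_matI) (auto simp: e'_def split: nat.splits)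
  have "U' * real_diag (Suc n) e' * mat_adjoint U' =
     four_block_mat (real_diag 1 (\<lambda>_. r)) (0\<^sub>m 1 n) (0\<^sub>m n 1) C"
    using Uc unfolding U'_def diag Ce
    by (simp add: mat_adjoint_four_block[of _ 1 1 _ n _ n] mult_four_block_mat[of _ 1 1 _ n _ n _ _ 1 _ n]
       mult_carrier_mat[of _ n n _ n])
  also have "\<dots> = B"
    using B by (intro eq_matI) (auto simp: B0 B0' C_def)
  finally have Beq: "B = U' * real_diag (Suc n) e' * mat_adjoint U'" by simp
  have "A = W * mat_adjoint W * A * (W * mat_adjoint W)" using A Wc by simp
  also have "\<dots> = W * B * mat_adjoint W"
    using A Wc(1,2) by (simp add: B_def assoc_mult_mat[of _ "Suc n" "Suc n" _ "Suc n" _ "Suc n"]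
      mult_carrier_mat[of _ "Suc n" "Suc n" _ "Suc n"])
  also have "\<dots> = (W * U') * real_diag (Suc n) e' * mat_adjoint (W * U')"
    using Wc(1,2) U'c(1,2) by (simp add: Beq mat_adjoint_mult[of _ "Suc n" "Suc n" _ "Suc n"]
      assoc_mult_mat[of _ "Suc n" "Suc n" _ "Suc n" _ "Suc n"]
      mult_carrier_mat[of _ "Suc n" "Suc n" _ "Suc n"])
  finally show ?case using unitary_mat_mult[OF W U'] by blast
qed

section \<open>Absolute values and singular values\<close>

lemma real_diag_mult_index:
  assumes "M \<in> carrier_mat n n" "i < n" "j < n"
  shows "(real_diag n e * M) $$ (i, j) = of_real (e i) * M $$ (i, j)"
    and "(M * real_diag n e) $$ (i, j) = M $$ (i, j) * of_real (e j)"
  using assms by (simp_all add: scalar_prod_def if_distrib[of "\<lambda>x. x * _"] if_distrib[of "(*) _"] cong: if_cong)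

lemma mat_trace_commute:
  fixes A B :: "'a::real_or_complex mat"
  assumes "A \<in> carrier_mat n k" "B \<in> carrier_mat k n"
  shows "mat_trace (A * B) = mat_trace (B * A)"
proof -
  have "mat_trace (A * B) = (\<Sum>i<n. \<Sum>j<k. A $$ (i, j) * B $$ (j, i))"
    using assms by (auto simp: mat_trace_def scalar_prod_def lessThan_atLeast0 intro!: sum.cong)
  also have "\<dots> = (\<Sum>j<k. \<Sum>i<n. A $$ (i, j) * B $$ (j, i))" by (rule sum.swap)
  also have "\<dots> = mat_trace (B * A)"
    using assms by (auto simp: mat_trace_def scalar_prod_def lessThan_atLeast0 mult.commute intro!: sum.cong)
  finally show ?thesis .
qed

section \<open>Functional calculus of a diagonalized matrix\<close>

context
  fixes n :: nat and U :: "'a::real_or_complex mat"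
  assumes U: "unitary_mat n U"
begin

private lemma c: "U \<in> carrier_mat n n" "mat_adjoint U \<in> carrier_mat n n"
    "mat_adjoint U * U = 1\<^sub>m n" "U * mat_adjoint U = 1\<^sub>m n"
  using unitary_matD[OF U] .

lemma unitary_conj_mult:
  "(U * real_diag n e * mat_adjoint U) * (U * real_diag n f * mat_adjoint U) =
    U * real_diag n (\<lambda>i. e i * f i) * mat_adjoint U"
proof -
  have "(U * real_diag n e * mat_adjoint U) * (U * real_diag n f * mat_adjoint U) =
      U * (real_diag n e * (mat_adjoint U * U) * real_diag n f) * mat_adjoint U"
    using c(1,2) by (simp add: assoc_mult_mat[of _ n n _ n _ n] mult_carrier_mat[of _ n n _ n])
  also have "\<dots> = U * (real_diag n e * real_diag n f) * mat_adjoint U"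
    using c(3) by (simp add: right_mult_one_mat[of _ n n])
  finally show ?thesis by (simp add: real_diag_mult)
qed

lemma unitary_conj_carrier [simp]: "U * real_diag n e * mat_adjoint U \<in> carrier_mat n n"
  using c(1,2) by (simp add: mult_carrier_mat[of _ n n _ n])

lemma unitary_conj_adjoint:
  "mat_adjoint (U * real_diag n e * mat_adjoint U) = U * real_diag n e * mat_adjoint U"
  using c(1,2) by (simp add: mat_adjoint_mult[of _ n n _ n] assoc_mult_mat[of _ n n _ n _ n]
      mult_carrier_mat[of _ n n _ n])

lemma char_poly_unitary_conj:
  "char_poly (U * real_diag n e * mat_adjoint U) = (\<Prod>i<n. [:- of_real (e i), 1:])"
proof -
  have "similar_mat_wit (U * real_diag n e * mat_adjoint U) (real_diag n e) U (mat_adjoint U)"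
    by (rule similar_mat_witI[of _ _ n]) (use c in auto)
  then show ?thesis
    unfolding char_poly_real_diag[symmetric] by (intro char_poly_similar) (auto simp only: similar_mat_def)
qed

lemma mat_trace_unitary_conj: "mat_trace (U * real_diag n e * mat_adjoint U) = of_real (\<Sum>i<n. e i)"
proof -
  have "mat_trace (U * real_diag n e * mat_adjoint U) = mat_trace (mat_adjoint U * (U * real_diag n e))"
    by (rule mat_trace_commute[of _ n n]) (use c in auto)
  also have "mat_adjoint U * (U * real_diag n e) = (mat_adjoint U * U) * real_diag n e"
    using c(1,2) by (simp add: assoc_mult_mat[of _ n n _ n _ n])
  also have "\<dots> = real_diag n e" using c(3) by simp
  finally show ?thesis by (simp add: mat_trace_def)
qed

lemma cscalar_prod_unitary_conj:
  assumes x: "x \<in> carrier_vec n"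
  shows "((U * real_diag n e * mat_adjoint U) *\<^sub>v x) \<bullet>c x =
    of_real (\<Sum>i<n. e i * (norm ((mat_adjoint U *\<^sub>v x) $ i))\<^sup>2)"
proof -
  define y where "y = mat_adjoint U *\<^sub>v x"
  have y: "y \<in> carrier_vec n" unfolding y_def by (rule mult_mat_vec_carrier[OF c(2) x])
  have D: "real_diag n e *\<^sub>v y = vec n (\<lambda>i. of_real (e i) * y $ i)"
    using y by (intro eq_vecI) (simp_all add: scalar_prod_def if_distrib[of "\<lambda>x. x * _"] cong: if_cong)
  have "((U * real_diag n e * mat_adjoint U) *\<^sub>v x) \<bullet>c x = (U *\<^sub>v (real_diag n e *\<^sub>v y)) \<bullet>c x"
    using assoc_mult_mat_vec[of "U * real_diag n e" n n "mat_adjoint U" n x]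
      assoc_mult_mat_vec[of U n n "real_diag n e" n y] c(1,2) x y
    by (simp add: y_def mult_carrier_mat[of _ n n _ n])
  also have "\<dots> = (real_diag n e *\<^sub>v y) \<bullet>c y"
    using cscalar_prod_adjoint[OF c(1) mult_mat_vec_carrier[OF real_diag_carrier y] x] by (simp add: y_def)
  also have "\<dots> = of_real (\<Sum>i<n. e i * (norm (y $ i))\<^sup>2)"
    using y by (auto simp: D scalar_prod_def lessThan_atLeast0 mult_conjugate_of_real mult.assoc intro!: sum.cong)
  finally show ?thesis by (simp add: y_def)
qed

lemma pos_semidef_unitary_conj:
  "pos_semidef n (U * real_diag n e * mat_adjoint U) \<longleftrightarrow> (\<forall>i<n. 0 \<le> e i)"
proof
  assume "\<forall>i<n. 0 \<le> e i"
  then have "0 \<le> (\<Sum>i<n. e i * (norm ((mat_adjoint U *\<^sub>v x) $ i))\<^sup>2)" for x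
    by (auto intro!: sum_nonneg)
  then show "pos_semidef n (U * real_diag n e * mat_adjoint U)"
    unfolding pos_semidef_def using cscalar_prod_unitary_conj unitary_conj_adjoint unitary_conj_carrier
    by blast
next
  assume psd: "pos_semidef n (U * real_diag n e * mat_adjoint U)"
  show "\<forall>i<n. 0 \<le> e i"
  proof (intro allI impI)
    fix i assume i: "i < n"
    \<comment> \<open>Column i of \<open>U\<close> is the eigenvector for \<open>e i\<close>; as a
      test vector it isolates that eigenvalue in the quadratic form.\<close>
    have "mat_adjoint U *\<^sub>v col U i = col (mat_adjoint U * U) i"
      using c(1,2) i by (intro col_mult2[symmetric]) auto
    then have e: "mat_adjoint U *\<^sub>v col U i = unit_vec n i" using c(3) i by simp
    have "(\<Sum>k<n. e k * (norm (unit_vec n i $ k :: 'a))\<^sup>2) = (\<Sum>k<n. if i = k then e i else 0)"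
      using i by (intro sum.cong) auto
    then have "(\<Sum>k<n. e k * (norm (unit_vec n i $ k :: 'a))\<^sup>2) = e i" using i by simp
    moreover have col: "col U i \<in> carrier_vec n" using c(1) by auto
    ultimately have "((U * real_diag n e * mat_adjoint U) *\<^sub>v col U i) \<bullet>c col U i = of_real (e i)"
      using cscalar_prod_unitary_conj[of "col U i" e] by (simp only: e)
    with col show "0 \<le> e i" using psd unfolding pos_semidef_def by (metis of_real_eq_iff)
  qed
qed

end

section \<open>Absolute value and trace norm\<close>

text \<open>Between the two eigenbases, \<open>D\<close> satisfies b_i^2 D_ij = D_ij c_j^2. Where
  D_ij is nonzero, nonnegativity upgrades this to b_i = c_j, so \<open>D\<close> also intertwines
  the unsquared diagonals. This gives the description in \<open>mat_abs\<close> its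
  uniqueness.\<close>

lemma pos_semidef_square_unique:
  fixes B C :: "'a::real_or_complex mat"
  assumes B: "pos_semidef n B" and C: "pos_semidef n C" and eq: "B * B = C * C"
  shows "B = C"
proof -
  obtain U b where U: "unitary_mat n U" and Bb: "B = U * real_diag n b * mat_adjoint U"
    using hermitian_spectral[of B n] B by (auto simp: pos_semidef_def)
  obtain W c where W: "unitary_mat n W" and Cc: "C = W * real_diag n c * mat_adjoint W"
    using hermitian_spectral[of C n] C by (auto simp: pos_semidef_def)
  have b: "b i \<ge> 0" and c: "c i \<ge> 0" if "i < n" for i
    using B C that by (simp_all add: Bb Cc pos_semidef_unitary_conj U W)
  note Uc = unitary_matD[OF U] and Wc = unitary_matD[OF W]
  define D where "D = mat_adjoint U * W"
  have D: "D \<in> carrier_mat n n" unfolding D_def by (rule mult_carrier_mat[OF Uc(2) Wc(1)])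
  have conj: "mat_adjoint U * (U * real_diag n f * mat_adjoint U) * W = real_diag n f * D" for f
  proof -
    have "mat_adjoint U * (U * real_diag n f * mat_adjoint U) * W =
       (mat_adjoint U * U) * real_diag n f * D"
      using Uc(1,2) Wc(1,2) by (simp add: D_def assoc_mult_mat[of _ n n _ n _ n] mult_carrier_mat[of _ n n _ n])
    then show ?thesis using Uc(3) by simp
  qed
  have conj': "mat_adjoint U * (W * real_diag n f * mat_adjoint W) * W = D * real_diag n f" for f
  proof -
    have "mat_adjoint U * (W * real_diag n f * mat_adjoint W) * W =
       D * real_diag n f * (mat_adjoint W * W)"
      using Uc(1,2) Wc(1,2) by (simp add: D_def assoc_mult_mat[of _ n n _ n _ n] mult_carrier_mat[of _ n n _ n])
    then show ?thesis using Wc(3) D by (simp add: right_mult_one_mat[of _ n n])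
  qed
  have sq: "real_diag n (\<lambda>i. b i * b i) * D = D * real_diag n (\<lambda>i. c i * c i)"
    using arg_cong[OF eq, of "\<lambda>M. mat_adjoint U * M * W"]
    by (simp add: Bb Cc unitary_conj_mult U W conj conj')
  have "real_diag n b * D = D * real_diag n c"
  proof (rule eq_matI)
    fix i j assume ij: "i < dim_row (D * real_diag n c)" "j < dim_col (D * real_diag n c)"
    then have ij: "i < n" "j < n" using D by auto
    have "of_real (b i * b i) * D $$ (i, j) = D $$ (i, j) * of_real (c j * c j)"
      using arg_cong[OF sq, of "\<lambda>M. M $$ (i, j)"] ij by (simp add: real_diag_mult_index[OF D])
    then have "D $$ (i, j) = 0 \<or> of_real (b i * b i) = (of_real (c j * c j) :: 'a)"
      by (metis mult.commute mult_cancel_left)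
    then have "D $$ (i, j) = 0 \<or> b i * b i = c j * c j" by (simp only: of_real_eq_iff)
    then have "D $$ (i, j) = 0 \<or> b i = c j"
      using b[OF ij(1)] c[OF ij(2)] by (metis real_sqrt_abs2 abs_of_nonneg)
    then show "(real_diag n b * D) $$ (i, j) = (D * real_diag n c) $$ (i, j)"
      using ij by (auto simp: real_diag_mult_index[OF D])
  qed (use D in auto)
  then have "mat_adjoint U * B * W = mat_adjoint U * C * W"
    by (simp add: Bb Cc conj conj')
  then have "U * (mat_adjoint U * B * W) * mat_adjoint W = U * (mat_adjoint U * C * W) * mat_adjoint W"
    by simp
  moreover have "U * (mat_adjoint U * M * W) * mat_adjoint W = M" if M: "M \<in> carrier_mat n n" for M
  proof -
    have "U * (mat_adjoint U * M * W) * mat_adjoint W = (U * mat_adjoint U) * M * (W * mat_adjoint W)"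
      using Uc(1,2) Wc(1,2) M by (simp add: assoc_mult_mat[of _ n n _ n _ n] mult_carrier_mat[of _ n n _ n])
    also have "\<dots> = M" using M Uc Wc by simp
    finally show ?thesis .
  qed
  ultimately show ?thesis using B C unfolding pos_semidef_def by metis
qed

lemma pos_semidef_adjoint_mult:
  fixes A :: "'a::real_or_complex mat"
  assumes A: "A \<in> carrier_mat k n"
  shows "pos_semidef n (mat_adjoint A * A)"
  unfolding pos_semidef_def
proof (intro conjI ballI)
  show "mat_adjoint (mat_adjoint A * A) = mat_adjoint A * A"
    using A by (simp add: mat_adjoint_mult[of _ n k _ n])
  fix x :: "'a vec" assume x: "x \<in> carrier_vec n"
  have "((mat_adjoint A * A) *\<^sub>v x) \<bullet>c x = (mat_adjoint A *\<^sub>v (A *\<^sub>v x)) \<bullet>c x"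
    using A x by (simp add: assoc_mult_mat_vec[of _ n k _ n])
  also have "\<dots> = (A *\<^sub>v x) \<bullet>c (A *\<^sub>v x)"
    using cscalar_prod_adjoint[of "mat_adjoint A" n k "A *\<^sub>v x" x] A x by simp
  finally show "\<exists>r\<ge>0. ((mat_adjoint A * A) *\<^sub>v x) \<bullet>c x = of_real r"
    unfolding cscalar_prod_self by (meson sum_nonneg zero_le_power2)
qed (use A in auto)

text \<open>The link between the hypothesis, a sum of singular values, and the error norm, governed
  by a spectrum: a single family \<sigma> serves both. It consists of the square roots of the
  eigenvalues of \<open>mat_adjoint A * A\<close>, in no particular order.\<close>

lemma trace_abs_eigenvalues:
  fixes A :: "'a::real_or_complex mat"
  assumes A: "A \<in> carrier_mat k n"
  shows "\<exists>\<sigma>. (\<forall>i<n. 0 \<le> \<sigma> i) \<and> trace_abs A = (\<Sum>i<n. \<sigma> i) \<and>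
    char_poly (mat_adjoint A * A) = (\<Prod>i<n. [:- of_real ((\<sigma> i)\<^sup>2), 1:])"
proof -
  note psd = pos_semidef_adjoint_mult[OF A]
  obtain U h where U: "unitary_mat n U" and h: "mat_adjoint A * A = U * real_diag n h * mat_adjoint U"
    using hermitian_spectral[of "mat_adjoint A * A" n] psd by (auto simp: pos_semidef_def)
  have h0: "\<forall>i<n. 0 \<le> h i" using psd by (simp add: h pos_semidef_unitary_conj[OF U])
  define B where "B = U * real_diag n (\<lambda>i. sqrt (h i)) * mat_adjoint U"
  have psdB: "pos_semidef n B" using h0 by (simp add: B_def pos_semidef_unitary_conj[OF U])
  have "real_diag n (\<lambda>i. sqrt (h i) * sqrt (h i)) = (real_diag n h :: 'a mat)"
    using h0 by (intro eq_matI) (auto simp del: of_real_mult)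
  then have BB: "B * B = mat_adjoint A * A"
    by (simp add: B_def unitary_conj_mult[OF U] h)
  have "mat_abs A = B"
    unfolding mat_abs_def
  proof (rule the_equality)
    have n: "dim_col A = n" using A by simp
    show "pos_semidef (dim_col A) B \<and> B * B = mat_adjoint A * A"
      unfolding n using psdB BB by (rule conjI)
    show "C = B" if "pos_semidef (dim_col A) C \<and> C * C = mat_adjoint A * A" for C
    proof (rule pos_semidef_square_unique)
      show "pos_semidef n C" using that unfolding n by (rule conjunct1)
      show "C * C = B * B" using that unfolding BB by (rule conjunct2)
    qed (rule psdB)
  qed
  then have "mat_trace (mat_abs A) = of_real (\<Sum>i<n. sqrt (h i))"
    by (simp add: B_def mat_trace_unitary_conj[OF U])
  then have "trace_abs A = (\<Sum>i<n. sqrt (h i))"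
    unfolding trace_abs_def by (intro the_equality) (auto simp del: of_real_sum)
  moreover have "char_poly (mat_adjoint A * A) = (\<Prod>i<n. [:- of_real ((sqrt (h i))\<^sup>2), 1:])"
    unfolding h char_poly_unitary_conj[OF U] using h0
    by (intro prod.cong refl) (simp del: of_real_power)
  ultimately show ?thesis using h0 by (intro exI[of _ "\<lambda>i. sqrt (h i)"]) auto
qed

section \<open>Multisets of roots and singular values\<close>

text \<open>Both products have the same multiset of roots \<open>proots\<close>, and equal multisets
  of list entries differ by a permutation of positions.\<close>

lemma prod_linear_factors_permutes:
  fixes a b :: "nat \<Rightarrow> 'a::idom"
  assumes "(\<Prod>i<n. [:- a i, 1:]) = (\<Prod>i<n. [:- b i, 1:])"
  shows "\<exists>p. p permutes {..<n} \<and> (\<forall>i<n. a i = b (p i))"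
proof -
  have proots: "proots (\<Prod>i<n. [:- f i, 1:]) = mset (map f [0..<n])" for f :: "nat \<Rightarrow> 'a"
    by (induction n) (simp_all add: proots_mult prod_zero_iff del: mult_pCons_left mult_pCons_right)
  have "mset (map a [0..<n]) = mset (map b [0..<n])"
    using assms by (metis proots)
  then obtain p where p: "p permutes {..<length (map b [0..<n])}"
    "permute_list p (map b [0..<n]) = map a [0..<n]"
    by (rule mset_eq_permutation)
  then have "a i = b (p i)" if "i < n" for i
    using that permute_list_nth[of p "map b [0..<n]" i] permutes_in_image[of p "{..<n}" i] by simp
  with p show ?thesis by auto
qed

text \<open>The family \<open>s\<close> may be unsorted and of any sign, since only its squares are
  fixed by the characteristic polynomial. The conclusion leaves exactly the ambiguity, order and
  sign, that a symmetric gauge ignores.\<close>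

lemma singular_values_permutes:
  fixes A :: "'a::real_or_complex mat"
  assumes A: "A \<in> carrier_mat k n"
    and s: "char_poly (mat_adjoint A * A) = (\<Prod>i<n. [:- of_real ((s i)\<^sup>2), 1:])"
  shows "\<exists>p. p permutes {..<n} \<and> singular_values A = vec n (\<lambda>i. \<bar>s (p i)\<bar>)"
proof -
  define P where "P t \<longleftrightarrow> t \<in> carrier_vec n \<and> (\<forall>i < n. 0 \<le> t $ i) \<and>
     (\<forall>i j. i \<le> j \<longrightarrow> j < n \<longrightarrow> t $ j \<le> t $ i) \<and>
     char_poly (mat_adjoint A * A) = (\<Prod>i<n. [:- of_real ((t $ i)\<^sup>2), 1:])" for t :: "real vec"
  have perm: "\<exists>p. p permutes {..<n} \<and> t = vec n (\<lambda>i. \<bar>s (p i)\<bar>)" if "P t" for t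
  proof -
    have "(\<Prod>i<n. [:- of_real ((t $ i)\<^sup>2), 1:]) = (\<Prod>i<n. [:- of_real ((s i)\<^sup>2), 1 :: 'a:])"
      using \<open>P t\<close> s unfolding P_def by (elim conjE) (rule trans[OF sym])
    from prod_linear_factors_permutes[OF this] obtain p where "p permutes {..<n}"
      and p: "\<And>i. i < n \<Longrightarrow> of_real ((t $ i)\<^sup>2) = (of_real ((s (p i))\<^sup>2) :: 'a)"
      by blast
    moreover have "t $ i = \<bar>s (p i)\<bar>" if i: "i < n" for i
    proof -
      have "(t $ i)\<^sup>2 = (s (p i))\<^sup>2" using p[OF i] by (simp only: of_real_eq_iff)
      then have "\<bar>t $ i\<bar> = \<bar>s (p i)\<bar>" by (simp only: power2_eq_iff abs_eq_iff)
      moreover have "0 \<le> t $ i" using \<open>P t\<close> i by (simp add: P_def)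
      ultimately show ?thesis by simp
    qed
    ultimately show ?thesis using that by (intro exI[of _ p]) (auto simp: P_def)
  qed
  \<comment> \<open>Existence: the absolute values in decreasing order. Uniqueness follows because
    every vector with property \<open>P\<close> lists this same multiset in decreasing
    order.\<close>
  define xs where "xs = rev (sort (map (\<lambda>i. \<bar>s i\<bar>) [0..<n]))"
  have msx: "mset xs = mset (map (\<lambda>i. \<bar>s i\<bar>) [0..<n])" by (simp add: xs_def)
  have len: "length xs = n" by (simp add: xs_def)
  obtain q where q: "q permutes {..<n}" and xsq: "\<And>i. i < n \<Longrightarrow> xs ! i = \<bar>s (q i)\<bar>"
  proof -
    obtain q where "q permutes {..<length (map (\<lambda>i. \<bar>s i\<bar>) [0..<n])}"
      "permute_list q (map (\<lambda>i. \<bar>s i\<bar>) [0..<n]) = xs"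
      using msx by (rule mset_eq_permutation)
    then have q: "q permutes {..<n}" and xs: "permute_list q (map (\<lambda>i. \<bar>s i\<bar>) [0..<n]) = xs"
      by (simp_all only: length_map length_upt diff_zero)
    show ?thesis
    proof (rule that[OF q])
      fix i assume "i < n"
      moreover from this have "q i < n" using permutes_in_image[OF q, of i] by simp
      ultimately show "xs ! i = \<bar>s (q i)\<bar>"
        using q permute_list_nth[of q "map (\<lambda>i. \<bar>s i\<bar>) [0..<n]" i] by (simp add: xs del: permute_list_map)
    qed
  qed
  define t where "t = vec n (\<lambda>i. xs ! i)"
  have Pt: "P t"
    unfolding P_def
  proof (intro conjI allI impI)
    fix i j :: nat assume ij: "i \<le> j" "j < n"
    have "sorted (rev xs)" by (simp add: xs_def)
    then show "t $ j \<le> t $ i" using ij len by (simp add: t_def sorted_rev_nth_mono)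
  next
    have "(\<Prod>i<n. [:- of_real ((t $ i)\<^sup>2), 1:]) = (\<Prod>i<n. [:- of_real ((s (q i))\<^sup>2), 1:] :: 'a poly)"
      by (rule prod.cong) (auto simp: t_def xsq)
    also have "\<dots> = (\<Prod>i<n. [:- of_real ((s i)\<^sup>2), 1:])"
      by (rule prod.reindex_bij_betw[OF permutes_imp_bij[OF q]])
    finally show "char_poly (mat_adjoint A * A) = (\<Prod>i<n. [:- of_real ((t $ i)\<^sup>2), 1:])"
      using s by simp
  qed (auto simp: t_def xsq)
  have uniq: "t' = t" if "P t'" for t'
  proof -
    have ms: "mset (map (\<lambda>i. u $ i) [0..<n]) = mset (map (\<lambda>i. \<bar>s i\<bar>) [0..<n])"
      and srt: "sorted (rev (map (\<lambda>i. u $ i) [0..<n]))" if "P u" for u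
    proof -
      obtain p where p: "p permutes {..<n}" "u = vec n (\<lambda>i. \<bar>s (p i)\<bar>)" using perm[OF \<open>P u\<close>] by blast
      have "map (\<lambda>i. u $ i) [0..<n] = permute_list p (map (\<lambda>i. \<bar>s i\<bar>) [0..<n])"
        using p permutes_in_image[OF p(1)] by (intro nth_equalityI) (auto simp: permute_list_nth)
      then show "mset (map (\<lambda>i. u $ i) [0..<n]) = mset (map (\<lambda>i. \<bar>s i\<bar>) [0..<n])"
        using p(1) by simp
      show "sorted (rev (map (\<lambda>i. u $ i) [0..<n]))"
        using \<open>P u\<close> by (auto simp: sorted_rev_iff_nth_mono P_def)
    qed
    have "sort (map (\<lambda>i. \<bar>s i\<bar>) [0..<n]) = rev (map (\<lambda>i. u $ i) [0..<n])" if "P u" for u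
      using ms[OF that] srt[OF that] by (intro properties_for_sort) (simp_all only: mset_rev)
    from this[OF that] this[OF Pt]
    have "rev (map (\<lambda>i. t' $ i) [0..<n]) = rev (map (\<lambda>i. t $ i) [0..<n])" by simp
    then have "map (\<lambda>i. t' $ i) [0..<n] = map (\<lambda>i. t $ i) [0..<n]" by simp
    then have "t' $ i = t $ i" if "i < n" for i using that by (auto simp: map_eq_conv)
    then show ?thesis using \<open>P t'\<close> Pt by (intro eq_vecI) (auto simp: P_def)
  qed
  have "singular_values A = (THE t. P t)" using A by (simp add: singular_values_def P_def)
  also have "\<dots> = t" using Pt uniq by (rule the_equality)
  finally show ?thesis using perm[OF Pt] by simp
qed

section \<open>Gauge functions and norms of Hermitian matrices\<close>

lemma symmetric_gauge_permute:
  assumes "symmetric_gauge n \<psi>" "p permutes {..<n}"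
  shows "\<psi> (vec n (\<lambda>i. s (p i))) = \<psi> (vec n s)"
proof -
  have "vec n s \<in> carrier_vec n" by simp
  with assms have "\<psi> (vec n (\<lambda>i. vec n s $ p i)) = \<psi> (vec n s)"
    unfolding symmetric_gauge_def by blast
  moreover have "vec n (\<lambda>i. vec n s $ p i) = vec n (\<lambda>i. s (p i))"
    using permutes_in_image[OF assms(2)] by (intro eq_vecI) auto
  ultimately show ?thesis by simp
qed

lemma symmetric_gauge_abs:
  assumes "symmetric_gauge n \<psi>"
  shows "\<psi> (vec n (\<lambda>i. \<bar>s i\<bar>)) = \<psi> (vec n s)"
proof -
  define \<epsilon> :: "nat \<Rightarrow> real" where "\<epsilon> i = (if s i < 0 then - 1 else 1)" for i
  have "\<psi> (vec n (\<lambda>i. \<epsilon> i * vec n s $ i)) = \<psi> (vec n s)"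
    using assms unfolding symmetric_gauge_def by (auto simp: \<epsilon>_def)
  moreover have "vec n (\<lambda>i. \<epsilon> i * vec n s $ i) = vec n (\<lambda>i. \<bar>s i\<bar>)"
    by (intro eq_vecI) (auto simp: \<epsilon>_def)
  ultimately show ?thesis by simp
qed

lemma symmetric_gauge_scale:
  assumes "symmetric_gauge n \<psi>"
  shows "\<psi> (vec n (\<lambda>i. c * s i)) = \<bar>c\<bar> * \<psi> (vec n s)"
proof -
  have "\<psi> (c \<cdot>\<^sub>v vec n s) = \<bar>c\<bar> * \<psi> (vec n s)"
    using assms unfolding symmetric_gauge_def by simp
  moreover have "c \<cdot>\<^sub>v vec n s = vec n (\<lambda>i. c * s i)" by auto
  ultimately show ?thesis by simp
qed

lemma symmetric_gauge_triangle:
  assumes "symmetric_gauge n \<psi>"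
  shows "\<psi> (vec n (\<lambda>i. s i + t i)) \<le> \<psi> (vec n s) + \<psi> (vec n t)"
proof -
  have "\<psi> (vec n s + vec n t) \<le> \<psi> (vec n s) + \<psi> (vec n t)"
    using assms unfolding symmetric_gauge_def by simp
  moreover have "vec n s + vec n t = vec n (\<lambda>i. s i + t i)" by auto
  ultimately show ?thesis by simp
qed

lemma symmetric_gauge_sum:
  fixes K :: nat
  assumes "symmetric_gauge n \<psi>"
  shows "\<psi> (vec n (\<lambda>i. \<Sum>k<K. f k i)) \<le> (\<Sum>k<K. \<psi> (vec n (f k)))"
proof (induction K)
  case 0
  show ?case using symmetric_gauge_scale[OF assms, of 0] by simp
next
  case (Suc K)
  then show ?case using symmetric_gauge_triangle[OF assms, of "\<lambda>i. \<Sum>k<K. f k i" "f K"] by simp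
qed

text \<open>A Hermitian matrix has \<open>mat_adjoint A * A\<close> equal to its square, so its
  singular values are the absolute values of its eigenvalues; the gauge absorbs signs and order.
  Norms can thus be computed from any factorization of the characteristic polynomial.\<close>

lemma norm_hermitian_eq_gauge:
  fixes A :: "'a::real_or_complex mat"
  assumes N: "associated_gauge N \<psi>" and n: "n > 0"
    and A: "A \<in> carrier_mat n n" "mat_adjoint A = A"
    and s: "char_poly A = (\<Prod>i<n. [:- of_real (s i), 1:])"
  shows "N n A = \<psi> n (vec n s)"
proof -
  have g: "symmetric_gauge n (\<psi> n)" and NA: "N n A = \<psi> n (singular_values A)"
    using N n A(1) by (auto simp: associated_gauge_def)
  obtain U e where U: "unitary_mat n U" and e: "A = U * real_diag n e * mat_adjoint U"
    using hermitian_spectral[OF A] by blast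
  have "char_poly (mat_adjoint A * A) = (\<Prod>i<n. [:- of_real ((e i)\<^sup>2), 1:])"
    unfolding A(2) unfolding e unitary_conj_mult[OF U] char_poly_unitary_conj[OF U]
    by (simp add: power2_eq_square)
  from singular_values_permutes[OF A(1) this] obtain q where
    q: "q permutes {..<n}" "singular_values A = vec n (\<lambda>i. \<bar>e (q i)\<bar>)" by blast
  have "(\<Prod>i<n. [:- of_real (s i), 1:]) = (\<Prod>i<n. [:- of_real (e i), 1 :: 'a:])"
    unfolding s[symmetric] e char_poly_unitary_conj[OF U] ..
  from prod_linear_factors_permutes[OF this] obtain p where
    p: "p permutes {..<n}" "\<And>i. i < n \<Longrightarrow> s i = e (p i)" by (auto simp only: of_real_eq_iff)
  have "N n A = \<psi> n (vec n e)"
    unfolding NA q(2) symmetric_gauge_abs[OF g] by (rule symmetric_gauge_permute[OF g q(1)])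
  also have "\<dots> = \<psi> n (vec n (\<lambda>i. e (p i)))"
    by (rule symmetric_gauge_permute[OF g p(1), symmetric])
  also have "vec n (\<lambda>i. e (p i)) = vec n s" using p(2) by auto
  finally show ?thesis .
qed

section \<open>Characteristic polynomials of block matrices\<close>

lemma char_poly_four_block_lower:
  fixes A :: "'a::idom mat"
  assumes "A \<in> carrier_mat n n" "C \<in> carrier_mat k n" "D \<in> carrier_mat k k"
  shows "char_poly (four_block_mat A (0\<^sub>m n k) C D) = char_poly A * char_poly D"
proof -
  have "char_poly_matrix (four_block_mat A (0\<^sub>m n k) C D) =
      four_block_mat (char_poly_matrix A) (0\<^sub>m n k) (map_mat (\<lambda>a. [:- a:]) C) (char_poly_matrix D)"
    using assms by (intro eq_matI) (auto simp: char_poly_matrix_def)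
  then show ?thesis
    unfolding char_poly_def using assms
    by (simp add: det_four_block_mat_upper_right_zero[of _ n _ k])
qed

text \<open>The two block matrices are similar via the unipotent block matrix with off-diagonal
  block \<open>P\<close>.\<close>
lemma char_poly_swap_block:
  fixes P :: "'a::field mat"
  assumes P: "P \<in> carrier_mat n k" and Q: "Q \<in> carrier_mat k n"
  shows "char_poly (four_block_mat (P * Q) (0\<^sub>m n k) (0\<^sub>m k n) (0\<^sub>m k k)) =
    char_poly (four_block_mat (Q * P) (0\<^sub>m k n) (0\<^sub>m n k) (0\<^sub>m n n))"
proof -
  define X where "X = four_block_mat (P * Q) (0\<^sub>m n k) Q (0\<^sub>m k k)"
  define Y where "Y = four_block_mat (0\<^sub>m n n) (0\<^sub>m n k) Q (Q * P)"
  define T where "T = four_block_mat (1\<^sub>m n) P (0\<^sub>m k n) (1\<^sub>m k)"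
  define T' where "T' = four_block_mat (1\<^sub>m n) (- P) (0\<^sub>m k n) (1\<^sub>m k)"
  note mult = mult_four_block_mat[of _ n n _ k _ k _ _ n _ k]
  have PQ: "P * Q \<in> carrier_mat n n" and QP: "Q * P \<in> carrier_mat k k" using P Q by auto
  have PQP: "P * Q * P = P * (Q * P)" using P Q by (rule assoc_mult_mat) (use P in auto)
  have c: "X \<in> carrier_mat (n + k) (n + k)" "Y \<in> carrier_mat (n + k) (n + k)"
    "T \<in> carrier_mat (n + k) (n + k)" "T' \<in> carrier_mat (n + k) (n + k)"
    using PQ QP by (simp_all add: X_def Y_def T_def T'_def)
  have "- 0\<^sub>m k k + 1\<^sub>m k = (1\<^sub>m k :: 'a mat)" by (intro eq_matI) auto
  then have TT': "T * T' = 1\<^sub>m (n + k)"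
    using P by (simp add: T_def T'_def mult[of "1\<^sub>m n"] uminus_l_inv_mat)
  have T'T: "T' * T = 1\<^sub>m (n + k)" using mat_mult_left_right_inverse[OF c(3,4) TT'] .
  have "X * T = four_block_mat (P * Q) (P * Q * P) Q (Q * P)"
    using P Q PQ QP unfolding X_def T_def by (subst mult) auto
  moreover have "T * Y = four_block_mat (P * Q) (P * Q * P) Q (Q * P)"
    using P Q PQ QP unfolding Y_def T_def PQP by (subst mult) auto
  ultimately have XT: "X * T = T * Y" by simp
  have "X = X * (T * T')" using TT' c by simp
  also have "\<dots> = X * T * T'" using c by simp
  also have "\<dots> = T * Y * T'" by (simp only: XT)
  finally have "similar_mat_wit X Y T T'"
    using c TT' T'T by (intro similar_mat_witI[of _ _ "n + k"])
  then have "char_poly X = char_poly Y"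
    by (intro char_poly_similar) (auto simp only: similar_mat_def)
  \<comment> \<open>\<open>X\<close> and \<open>Y\<close> are lower block triangular, so their
    off-diagonal block \<open>Q\<close> drops out.\<close>
  then have "char_poly (P * Q) * char_poly (0\<^sub>m k k) = char_poly (0\<^sub>m n n) * char_poly (Q * P)"
    using P Q PQ QP by (simp add: X_def Y_def char_poly_four_block_lower[of _ n _ k])
  then show ?thesis
    using PQ QP by (simp add: char_poly_four_block_lower[of _ n _ k] char_poly_four_block_lower[of _ k _ n]
      mult.commute)
qed

text \<open>The block determinant is that of (x - w)^2 I - A^* A, the characteristic matrix of A^* A
  with x replaced by q = (x - w)^2. Substitution is a ring homomorphism and passes through the
  determinant, and each factor q - \<sigma>^2 splits into x - (w + \<sigma>) and x - (w -
  \<sigma>).\<close>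

lemma char_poly_block_gram:
  fixes A :: "'a::real_or_complex mat"
  assumes A: "A \<in> carrier_mat l l"
    and \<sigma>: "char_poly (mat_adjoint A * A) = (\<Prod>i<l. [:- of_real ((\<sigma> i)\<^sup>2), 1:])"
  shows "char_poly (four_block_mat (of_real w \<cdot>\<^sub>m 1\<^sub>m l) (mat_adjoint A) A (of_real w \<cdot>\<^sub>m 1\<^sub>m l)) =
    (\<Prod>i<l + l. [:- of_real (if i < l then w + \<sigma> i else w - \<sigma> (i - l)), 1:])"
proof -
  let ?w = "of_real w :: 'a"
  define q where "q = [:- ?w, 1:] * [:- ?w, 1:]"
  have hom: "comm_ring_hom (\<lambda>p::'a poly. pcompose p q)"
    by unfold_locales (auto simp: pcompose_add pcompose_mult)
  let ?C = "map_mat (\<lambda>a. [:- a:])"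
  define G where "G = four_block_mat (?w \<cdot>\<^sub>m 1\<^sub>m l) (mat_adjoint A) A (?w \<cdot>\<^sub>m 1\<^sub>m l)"
  let ?D = "[:- ?w, 1:] \<cdot>\<^sub>m 1\<^sub>m l"
  define M where "M = mat_adjoint A * A"
  have M: "M \<in> carrier_mat l l" unfolding M_def using A by (intro mult_carrier_mat[of _ l l]) auto
  then have cM: "char_poly_matrix M \<in> carrier_mat l l" by simp
  have "char_poly_matrix G = four_block_mat ?D (?C (mat_adjoint A)) (?C A) ?D"
    using A by (intro eq_matI) (auto simp: G_def char_poly_matrix_def)
  then have "char_poly G = det (four_block_mat ?D (?C (mat_adjoint A)) (?C A) ?D)"
    by (simp add: char_poly_def)
  \<comment> \<open>The lower right block is a scalar matrix and commutes with the lower left one,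
    as the block determinant formula requires.\<close>
  also have "\<dots> = det (?D * ?D - ?C (mat_adjoint A) * ?C A)"
    using A by (intro det_four_block_mat[of _ l])
      (auto simp: mult_smult_distrib[of _ l l _ l] mult_smult_assoc_mat[of _ l l _ l])
  also have "?D * ?D - ?C (mat_adjoint A) * ?C A = map_mat (\<lambda>p. pcompose p q) (char_poly_matrix M)"
  proof (rule eq_matI, goal_cases)
    case (1 i j)
    then have ij: "i < l" "j < l" using cM by auto
    have const_sum: "[:(\<Sum>k = 0..<n. f k):] = (\<Sum>k = 0..<n. [:f k:])" for f :: "nat \<Rightarrow> 'a" and n
    proof (induction n)
      case (Suc n)
      have "[:(\<Sum>k = 0..<Suc n. f k):] = [:(\<Sum>k = 0..<n. f k):] + [:f n:]" by simp
      with Suc show ?case by simp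
    qed simp
    have "(?C (mat_adjoint A) * ?C A) $$ (i, j) = (\<Sum>k = 0..<l. [:conjugate (A $$ (k, i)) * A $$ (k, j):])"
      using ij A by (auto simp: scalar_prod_def intro!: sum.cong)
    also have "\<dots> = [:M $$ (i, j):]"
      using ij A by (simp add: M_def scalar_prod_def const_sum)
    finally have "(?C (mat_adjoint A) * ?C A) $$ (i, j) = [:M $$ (i, j):]" .
    moreover have "(?D * ?D) $$ (i, j) = (if i = j then q else 0)"
      using ij by (simp add: mult_smult_distrib[of _ l l _ l] mult_smult_assoc_mat[of _ l l _ l] q_def)
    moreover have "pcompose (char_poly_matrix M $$ (i, j)) q = (if i = j then q else 0) - [:M $$ (i, j):]"
      using ij M by (auto simp: char_poly_matrix_def pcompose_pCons)
    ultimately show ?case using ij A cM by simp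
  qed (use A cM in auto)
  also have "det (map_mat (\<lambda>p. pcompose p q) (char_poly_matrix M)) = pcompose (char_poly M) q"
    unfolding char_poly_def by (rule comm_ring_hom.hom_det[OF hom])
  also have "\<dots> = (\<Prod>i<l. pcompose [:- of_real ((\<sigma> i)\<^sup>2), 1:] q)"
    unfolding M_def \<sigma> by (rule pcompose_prod)
  also have "\<dots> = (\<Prod>i<l. [:- of_real (w + \<sigma> i), 1:] * [:- of_real (w - \<sigma> i), 1:])"
    by (rule prod.cong) (auto simp: q_def pcompose_pCons algebra_simps power2_eq_square)
  also have "\<dots> = (\<Prod>i<l. [:- of_real (w + \<sigma> i), 1:]) * (\<Prod>i<l. [:- of_real (w - \<sigma> i), 1:])"
    by (rule prod.distrib)
  also have "\<dots> = (\<Prod>i<l + l. [:- of_real (if i < l then w + \<sigma> i else w - \<sigma> (i - l)), 1:])"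
    unfolding lessThan_atLeast0 prod.atLeastLessThan_concat[symmetric, of 0 l "l + l", simplified]
    using prod.shift_bounds_nat_ivl[of "\<lambda>i. [:- of_real (if i < l then w + \<sigma> i else w - \<sigma> (i - l)), 1::'a:]" 0 l l]
    by simp
  finally show ?thesis by (simp only: G_def)
qed

text \<open>Padding with zero blocks to size \<open>d + 2 l\<close> makes the two products of \<open>W\<close> and its adjoint
  comparable, whichever of \<open>d\<close> and \<open>2 l\<close> is larger.\<close>
lemma norm_gram_sum:
  fixes N :: "nat \<Rightarrow> 'a::real_or_complex mat \<Rightarrow> real"
  assumes N: "compatible_ui_norm N" "associated_gauge N \<psi>"
    and pos: "l > 0" "d > 0"
    and X: "X \<in> carrier_mat l d" "X * mat_adjoint X = of_real w \<cdot>\<^sub>m 1\<^sub>m l"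
    and Y: "Y \<in> carrier_mat l d" "Y * mat_adjoint Y = of_real w \<cdot>\<^sub>m 1\<^sub>m l"
    and \<sigma>: "char_poly (mat_adjoint (X * mat_adjoint Y) * (X * mat_adjoint Y)) =
      (\<Prod>i<l. [:- of_real ((\<sigma> i)\<^sup>2), 1:])"
  shows "N d (mat_adjoint X * X + mat_adjoint Y * Y) =
    \<psi> (l + l) (vec (l + l) (\<lambda>i. if i < l then w + \<sigma> i else w - \<sigma> (i - l)))"
proof -
  define n where "n = l + l"
  define s where "s i = (if i < l then w + \<sigma> i else w - \<sigma> (i - l))" for i
  \<comment> \<open>The spectrum of the padded matrix: the 2 l values of \<open>s\<close> followed
    by d zeros.\<close>
  define s' where "s' i = (if i < n then s i else 0)" for i
  \<comment> \<open>\<open>Y\<close> is stacked above \<open>X\<close>; the right-hand blocks have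
    width 0 and only make block multiplication applicable. This order puts \<open>A\<close> in the
    lower left corner of the Gram matrix.\<close>
  define W where "W = four_block_mat Y (0\<^sub>m l 0) X (0\<^sub>m l 0)"
  define A where "A = X * mat_adjoint Y"
  have n: "n > 0" using pos by (simp add: n_def)
  have W: "W \<in> carrier_mat n d" using X Y by (auto simp: W_def n_def)
  have A: "A \<in> carrier_mat l l" and A': "mat_adjoint A = Y * mat_adjoint X"
    using X Y by (auto simp: A_def mat_adjoint_mult[of _ l d _ l])
  have W': "mat_adjoint W = four_block_mat (mat_adjoint Y) (mat_adjoint X) (0\<^sub>m 0 l) (0\<^sub>m 0 l)"
    using X Y by (simp add: W_def mat_adjoint_four_block[of _ l d _ 0 _ l])
  have WW': "W * mat_adjoint W = four_block_mat (of_real w \<cdot>\<^sub>m 1\<^sub>m l) (mat_adjoint A) A (of_real w \<cdot>\<^sub>m 1\<^sub>m l)"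
    using X Y A unfolding W' A' unfolding W_def A_def
    by (subst mult_four_block_mat[of _ l d _ 0 _ l _ _ l _ l]) auto
  define S where "S = mat_adjoint X * X + mat_adjoint Y * Y"
  have W'W: "mat_adjoint W * W = S"
  proof -
    have "mat_adjoint W * W = four_block_mat (mat_adjoint Y * Y + mat_adjoint X * X)
      (mat_adjoint Y * 0\<^sub>m l 0 + mat_adjoint X * 0\<^sub>m l 0) (0\<^sub>m 0 l * Y + 0\<^sub>m 0 l * X) (0\<^sub>m 0 l * 0\<^sub>m l 0 + 0\<^sub>m 0 l * 0\<^sub>m l 0)"
      using X Y unfolding W' unfolding W_def
      by (intro mult_four_block_mat[of _ d l _ l _ 0 _ _ d _ 0]) auto
    also have "\<dots> = S"
      using X Y by (intro eq_matI) (auto simp: S_def add.commute)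
    finally show ?thesis .
  qed
  have S: "S \<in> carrier_mat d d" using X Y by (auto simp: S_def)
  have hS: "mat_adjoint S = S"
    using W by (simp add: W'W[symmetric] mat_adjoint_mult[of _ d n _ d])
  define M where "M = four_block_mat S (0\<^sub>m d n) (0\<^sub>m n d) (0\<^sub>m n n)"
  have "char_poly M = char_poly (four_block_mat (W * mat_adjoint W) (0\<^sub>m n d) (0\<^sub>m d n) (0\<^sub>m d d))"
    using W unfolding M_def W'W[symmetric] by (intro char_poly_swap_block) auto
  also have "\<dots> = char_poly (W * mat_adjoint W) * char_poly (real_diag d (\<lambda>_. 0))"
  proof -
    have "0\<^sub>m d d = (real_diag d (\<lambda>_. 0) :: 'a mat)" by (intro eq_matI) auto
    then show ?thesis using W by (simp add: char_poly_four_block_lower[of _ n _ d])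
  qed
  also have "\<dots> = (\<Prod>i<n. [:- of_real (s i), 1:]) * (\<Prod>i<d. [:- of_real 0, 1:])"
    unfolding WW' char_poly_real_diag using char_poly_block_gram[OF A, of \<sigma> w] \<sigma>
    by (simp add: n_def s_def A_def)
  also have "\<dots> = (\<Prod>i<n + d. [:- of_real (s' i), 1:])"
    unfolding lessThan_atLeast0 prod.atLeastLessThan_concat[symmetric, of 0 n "n + d", simplified]
    using prod.shift_bounds_nat_ivl[of "\<lambda>i. [:- of_real (s' i), 1::'a:]" 0 n d]
    by (simp add: s'_def)
  finally have cpM: "char_poly M = (\<Prod>i<d + n. [:- of_real (s' i), 1:])" by (simp add: add.commute)
  have "N d S = N (d + n) M"
    using N(1) pos(2) S by (simp add: compatible_ui_norm_def M_def)
  also have "\<dots> = \<psi> (d + n) (vec (d + n) s')"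
    using S hS pos cpM by (intro norm_hermitian_eq_gauge[OF N(2)])
      (auto simp: M_def mat_adjoint_four_block[of _ d d _ n _ n])
  \<comment> \<open>The padded error is traded for a diagonal matrix with the same spectrum. Its
    zero block of size d can be stripped by compatibility, which brings the gauge down to order 2
    l.\<close>
  also have "\<dots> = N (n + d) (real_diag (n + d) s')"
    using n by (simp add: add.commute norm_hermitian_eq_gauge[OF N(2) _ _ _ char_poly_real_diag])
  also have "(real_diag (n + d) s' :: 'a mat) = four_block_mat (real_diag n s) (0\<^sub>m n d) (0\<^sub>m d n) (0\<^sub>m d d)"
    by (intro eq_matI) (auto simp: s'_def)
  also have "N (n + d) \<dots> = N n (real_diag n s)"
    using N(1) n by (simp add: compatible_ui_norm_def)
  also have "\<dots> = \<psi> n (vec n s)"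
    using n by (simp add: norm_hermitian_eq_gauge[OF N(2) _ _ _ char_poly_real_diag])
  finally show ?thesis unfolding S_def n_def s_def .
qed

section \<open>Averaging over permutations in a symmetric gauge\<close>

lemma bij_betw_add_mod: "bij_betw (\<lambda>i. (i + k) mod l) {..<l} {..<l::nat}"
proof -
  have *: "i = j" if "(i + k) mod l = (j + k) mod l" "i \<le> j" "j < l" for i j
  proof -
    have "l dvd (j + k) - (i + k)" using that by (metis mod_eq_dvd_iff_nat add_le_mono1)
    then have "l dvd j - i" by simp
    moreover have "j - i < l" using that by simp
    ultimately show ?thesis using that(2) by (metis dvd_imp_le le_antisym linorder_not_le zero_less_diff)
  qed
  then have "inj_on (\<lambda>i. (i + k) mod l) {..<l}"
    by (intro inj_onI) (metis lessThan_iff linorder_le_cases)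
  moreover have "(\<lambda>i. (i + k) mod l) ` {..<l} \<subseteq> {..<l}" by auto
  ultimately show ?thesis by (simp add: bij_betw_def endo_inj_surj)
qed

text \<open>Both reductions are convex combinations of permuted copies of one vector, so
  homogeneity, the triangle inequality and permutation invariance bound the gauge.\<close>

lemma symmetric_gauge_two_level_le:
  assumes g: "symmetric_gauge (l + l) \<psi>" and l: "l > 0"
    and c: "0 \<le> c" "real l * c \<le> (\<Sum>i<l. \<sigma> i)"
  shows "\<psi> (vec (l + l) (\<lambda>i. if i < l then w + c else w - c)) \<le>
    \<psi> (vec (l + l) (\<lambda>i. if i < l then w + \<sigma> i else w - \<sigma> (i - l)))"
proof -
  define n where "n = l + l"
  note g = g[folded n_def]
  define s where "s i = (if i < l then w + \<sigma> i else w - \<sigma> (i - l))" for i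
  define \<mu> where "\<mu> = (\<Sum>i<l. \<sigma> i) / real l"
  define t where "t i = (if i < l then w + \<mu> else w - \<mu>)" for i
  \<comment> \<open>The same shift acts in both halves, which average to w + \<mu> and w - \<mu>.
    Indices from n on stay fixed, as \<open>permutes\<close> demands.\<close>
  define p where "p k i = (if i < l then (i + k) mod l else if i < n then l + (i - l + k) mod l else i)" for k i
  have shift: "(\<Sum>k<l. \<sigma> ((i + k) mod l)) = real l * \<mu>" for i
    using sum.reindex_bij_betw[OF bij_betw_add_mod[of i l], of \<sigma>] l by (simp add: \<mu>_def add.commute)
  have p: "p k permutes {..<n}" for k
  proof (rule bij_imp_permutes)
    have 1: "bij_betw (p k) {..<l} {..<l}"
      using bij_betw_add_mod[of k l] by (rule bij_betw_cong[THEN iffD1, rotated]) (simp add: p_def)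
    have "bij_betw ((\<lambda>i. i + l) \<circ> (\<lambda>i. (i + k) mod l) \<circ> (\<lambda>i. i - l)) {l..<n} {l..<n}"
    proof (intro bij_betw_trans)
      show "bij_betw (\<lambda>i. i - l) {l..<n} {..<l}"
        by (rule bij_betw_byWitness[where f' = "\<lambda>i. i + l"]) (auto simp: n_def)
      show "bij_betw (\<lambda>i. i + l) {..<l} {l..<n}"
        by (rule bij_betw_byWitness[where f' = "\<lambda>i. i - l"]) (auto simp: n_def)
    qed (rule bij_betw_add_mod)
    then have 2: "bij_betw (p k) {l..<n} {l..<n}"
      by (rule bij_betw_cong[THEN iffD1, rotated]) (auto simp: p_def)
    have "{..<l} \<inter> {l..<n} = {}" "{..<l} \<union> {l..<n} = {..<n}" by (auto simp: n_def)
    then show "bij_betw (p k) {..<n} {..<n}" using bij_betw_combine[OF 1 2] by (simp only:)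
  qed (auto simp: p_def n_def)
  have "vec n (\<lambda>i. \<Sum>k<l. s (p k i)) = vec n (\<lambda>i. real l * t i)"
  proof (intro eq_vecI)
    fix i assume "i < dim_vec (vec n (\<lambda>i. real l * t i))"
    then have i: "i < n" by simp
    show "vec n (\<lambda>i. \<Sum>k<l. s (p k i)) $ i = vec n (\<lambda>i. real l * t i) $ i"
    proof (cases "i < l")
      case True
      then have "(\<Sum>k<l. s (p k i)) = (\<Sum>k<l. w + \<sigma> ((i + k) mod l))"
        by (intro sum.cong) (auto simp: s_def p_def)
      also have "\<dots> = real l * (w + \<mu>)" by (simp only: sum.distrib shift) (simp add: algebra_simps)
      finally show ?thesis using i True by (simp add: t_def)
    next
      case False
      then have "(\<Sum>k<l. s (p k i)) = (\<Sum>k<l. w - \<sigma> ((i - l + k) mod l))"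
        using i by (intro sum.cong) (auto simp: s_def p_def)
      also have "\<dots> = real l * (w - \<mu>)" by (simp only: sum_subtractf shift) (simp add: algebra_simps)
      finally show ?thesis using i False by (simp add: t_def)
    qed
  qed simp
  then have "real l * \<psi> (vec n t) \<le> (\<Sum>k<l. \<psi> (vec n (\<lambda>i. s (p k i))))"
    using symmetric_gauge_sum[OF g, of "\<lambda>k i. s (p k i)" l] symmetric_gauge_scale[OF g, of "real l" t] by simp
  also have "\<dots> = real l * \<psi> (vec n s)"
    by (simp only: symmetric_gauge_permute[OF g p, of s] sum_constant card_lessThan)
  finally have ts: "\<psi> (vec n t) \<le> \<psi> (vec n s)" using l by simp
  have c\<mu>: "c \<le> \<mu>" using c(2) l by (simp add: \<mu>_def field_simps)
  \<comment> \<open>If \<mu> = 0 then c = 0 as well, and division by zero yields \<theta> = 0, so c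
    = \<theta> * \<mu> holds in that case too.\<close>
  define \<theta> where "\<theta> = c / \<mu>"
  have \<theta>: "0 \<le> \<theta>" "\<theta> \<le> 1" and c\<theta>: "c = \<theta> * \<mu>"
    using c(1) c\<mu> by (auto simp: \<theta>_def divide_le_eq_1)
  define q where "q i = (if i < l then i + l else if i < n then i - l else i)" for i
  have q: "q permutes {..<n}"
    by (rule bij_imp_permutes, rule bij_betw_byWitness[where f' = q]) (auto simp: q_def n_def)
  \<comment> \<open>The weights solve a + b = 1 and a - b = \<theta>: mixing \<open>t\<close> with
    its block swap gives w + (a - b) \<mu> = w + c in the first half and w - c in the
    second.\<close>
  define a b where "a = (1 + \<theta>) / 2" and "b = (1 - \<theta>) / 2"
  have ab: "0 \<le> a" "0 \<le> b" "a + b = 1" "a - b = \<theta>" using \<theta> by (auto simp: a_def b_def field_simps)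
  have "vec n (\<lambda>i. if i < l then w + c else w - c) = vec n (\<lambda>i. a * t i + b * t (q i))"
    by (intro eq_vecI) (auto simp: t_def q_def n_def c\<theta> a_def b_def field_simps)
  then have "\<psi> (vec n (\<lambda>i. if i < l then w + c else w - c)) \<le> \<psi> (vec n (\<lambda>i. a * t i)) + \<psi> (vec n (\<lambda>i. b * t (q i)))"
    using symmetric_gauge_triangle[OF g, of "\<lambda>i. a * t i" "\<lambda>i. b * t (q i)"] by simp
  also have "\<dots> = a * \<psi> (vec n t) + b * \<psi> (vec n t)"
    using ab(1,2) by (simp only: symmetric_gauge_scale[OF g, of a t] symmetric_gauge_scale[OF g, of b "\<lambda>i. t (q i)"]
      symmetric_gauge_permute[OF g q, of t] abs_of_nonneg)
  also have "\<dots> = \<psi> (vec n t)" using ab(3) by (simp flip: distrib_right)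
  finally show ?thesis using ts unfolding n_def s_def by linarith
qed

section \<open>Protocols\<close>

lemma full_column_rank_kernel:
  fixes A :: "'a::field mat"
  assumes A: "A \<in> carrier_mat n k" and rank: "vec_space.rank n A = k"
    and v: "v \<in> carrier_vec k" "A *\<^sub>v v = 0\<^sub>v n"
  shows "v = 0\<^sub>v k"
proof (rule ccontr)
  assume v0: "v \<noteq> 0\<^sub>v k"
  interpret vec_space "TYPE('a)" n .
  \<comment> \<open>Linear independence speaks of the set of columns and cannot see repetitions. A
    repeated column would leave fewer than k distinct ones, hence a rank below k.\<close>
  have dist: "distinct (cols A)"
  proof (rule ccontr)
    assume nd: "\<not> distinct (cols A)"
    obtain S where S: "maximal S (\<lambda>T. T \<subseteq> set (cols A) \<and> lin_indpt T)"
      using maximal_exists[of "\<lambda>T. T \<subseteq> set (cols A) \<and> lin_indpt T" "card (set (cols A))" "{}"]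
      by (meson List.finite_set card_mono empty_iff empty_subsetI finite_lin_indpt2 rev_finite_subset)
    then have "card S \<le> card (set (cols A))" by (simp add: card_mono maximal_def)
    moreover have "card (set (cols A)) < k"
      using nd A card_distinct[of "cols A"] card_length[of "cols A"] by fastforce
    ultimately show False using rank_card_indpt[OF A S] rank by simp
  qed
  have "lin_dep (set (cols A))" by (rule lin_depI[OF A v(1) v0 v(2) dist])
  with full_rank_lin_indpt[OF A rank dist] show False by blast
qed

text \<open>Left cancellation of an injective matrix, column by column.\<close>

lemma full_column_rank_mult_zero:
  fixes A :: "'a::field mat"
  assumes A: "A \<in> carrier_mat n k" and rank: "vec_space.rank n A = k"
    and B: "B \<in> carrier_mat k p" and AB: "A * B = 0\<^sub>m n p"
  shows "B = 0\<^sub>m k p"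
proof -
  have "col B j = 0\<^sub>v k" if "j < p" for j
  proof (rule full_column_rank_kernel[OF A rank])
    have "A *\<^sub>v col B j = col (A * B) j" using A B that by (intro col_mult2[symmetric]) auto
    then show "A *\<^sub>v col B j = 0\<^sub>v n" using that by (simp add: AB)
  qed (use B in auto)
  then have "B $$ (i, j) = 0" if "i < k" "j < p" for i j
    using that B by (metis index_col index_zero_vec(1) carrier_matD)
  then show ?thesis using B by (intro eq_matI) auto
qed

text \<open>With B = X^*, idempotence of the projection reads (B X)(B X) = w B X. The rank condition
  makes \<open>B\<close> left cancellable; using this twice, with an adjoint in between, leaves X B
  = w I.\<close>

lemma uwp_rank_protocol_coisometry:
  fixes V :: "nat \<Rightarrow> 'a::real_or_complex mat"
  assumes V: "uwp_rank_protocol m l d V" and ml: "m * l > 0" and i: "i \<in> {1..m}"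
  shows "V i \<in> carrier_mat l d"
    and "V i * mat_adjoint (V i) = of_real (real d / (real m * real l)) \<cdot>\<^sub>m 1\<^sub>m l"
proof -
  have carr: "V i \<in> carrier_mat l d" if "i \<in> {1..m}" for i
    using V that by (auto simp: uwp_rank_protocol_def protocol_def)
  from i show "V i \<in> carrier_mat l d" by (rule carr)
  obtain w where w: "\<And>i. i \<in> {1..m} \<Longrightarrow>
      \<exists>P. orth_proj d P \<and> mat_adjoint (V i) * V i = of_real w \<cdot>\<^sub>m P"
    using V unfolding uwp_rank_protocol_def uw_projective_def by blast
  have VV: "V i * mat_adjoint (V i) = of_real w \<cdot>\<^sub>m 1\<^sub>m l" if i: "i \<in> {1..m}" for i
  proof -
    define X where "X = V i"
    define B where "B = mat_adjoint X"
    have X: "X \<in> carrier_mat l d" and B: "B \<in> carrier_mat d l"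
      using carr[OF i] by (simp_all add: X_def B_def)
    have rank: "vec_space.rank d B = l" using V i by (simp add: uwp_rank_protocol_def B_def X_def)
    obtain P where P: "orth_proj d P" and BX: "B * X = of_real w \<cdot>\<^sub>m P" using w[OF i] by (auto simp: B_def X_def)
    have Pc: "P \<in> carrier_mat d d" "P * P = P" using P by (auto simp: orth_proj_def)
    have XBX: "X * (B * X) \<in> carrier_mat l d" using X B by (intro mult_carrier_mat[of _ l d]) auto
    have "B * (X * (B * X)) = (B * X) * (B * X)"
      using assoc_mult_mat[OF B X, of "B * X" d] X B by simp
    also have "\<dots> = of_real w \<cdot>\<^sub>m (of_real w \<cdot>\<^sub>m P)"
      unfolding BX using Pc by (simp add: mult_smult_distrib[of _ d d _ d] mult_smult_assoc_mat[of _ d d _ d])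
    also have "\<dots> = B * (of_real w \<cdot>\<^sub>m X)"
      by (simp only: BX mult_smult_distrib[OF B X])
    finally have "B * (X * (B * X) - of_real w \<cdot>\<^sub>m X) = 0\<^sub>m d d"
      using X B XBX by (simp add: mult_minus_distrib_mat[of _ d l _ d])
    then have "X * (B * X) - of_real w \<cdot>\<^sub>m X = 0\<^sub>m l d"
      using X by (intro full_column_rank_mult_zero[OF B rank]) auto
    then have "X * (B * X) = of_real w \<cdot>\<^sub>m X" using X XBX by (intro eq_matI) (auto simp: mat_eq_iff)
    \<comment> \<open>Adjoints turn X B X = w X into B X B = w B, where \<open>B\<close> is again on
      the left and cancels once more.\<close>
    then have "mat_adjoint (X * (B * X)) = mat_adjoint (of_real w \<cdot>\<^sub>m X)" by simp
    moreover have "mat_adjoint (X * (B * X)) = B * (X * B)"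
      using mat_adjoint_mult[OF X mult_carrier_mat[OF B X]] mat_adjoint_mult[OF B X] assoc_mult_mat[OF B X B] X B
      by (simp add: B_def)
    ultimately have "B * (X * B) = of_real w \<cdot>\<^sub>m B" by (simp add: mat_adjoint_smult B_def)
    then have "B * (X * B - of_real w \<cdot>\<^sub>m 1\<^sub>m l) = 0\<^sub>m d l"
      using X B by (simp add: mult_minus_distrib_mat[of _ d l _ l] mult_smult_distrib[of _ d l _ l])
    then have "X * B - of_real w \<cdot>\<^sub>m 1\<^sub>m l = 0\<^sub>m l l"
      by (intro full_column_rank_mult_zero[OF B rank]) auto
    then have "X * B = of_real w \<cdot>\<^sub>m 1\<^sub>m l" using X B by (intro eq_matI) (auto simp: mat_eq_iff)
    then show ?thesis by (simp add: B_def X_def)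
  qed
  have one: "(\<Sum>i = 1..m. (mat_adjoint (V i) * V i) $$ (r, r)) = 1" if "r < d" for r
  proof -
    have "mat d d (\<lambda>(r, c). \<Sum>i = 1..m. (mat_adjoint (V i) * V i) $$ (r, c)) = 1\<^sub>m d"
      using V by (simp add: uwp_rank_protocol_def protocol_def)
    from arg_cong[OF this, of "\<lambda>M. M $$ (r, r)"] that show ?thesis
      unfolding index_mat(1)[OF that that] split by simp
  qed
  \<comment> \<open>The trace of the resolution of the identity is d; by cyclicity it equals the sum
    of the traces of \<open>V i * mat_adjoint (V i)\<close>, namely m l w.\<close>
  have "(\<Sum>r<d. \<Sum>i = 1..m. (mat_adjoint (V i) * V i) $$ (r, r)) = (\<Sum>r<d. 1)"
    by (intro sum.cong refl one) simp
  then have "of_real (real d) = (\<Sum>r<d. \<Sum>i = 1..m. (mat_adjoint (V i) * V i) $$ (r, r))" by simp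
  also have "\<dots> = (\<Sum>i = 1..m. \<Sum>r<d. (mat_adjoint (V i) * V i) $$ (r, r))" by (rule sum.swap)
  also have "\<dots> = (\<Sum>i = 1..m. mat_trace (mat_adjoint (V i) * V i))"
  proof (rule sum.cong)
    fix i assume "i \<in> {1..m}"
    from carr[OF this] show "(\<Sum>r<d. (mat_adjoint (V i) * V i) $$ (r, r)) = mat_trace (mat_adjoint (V i) * V i)"
      by (auto simp: mat_trace_def)
  qed simp
  also have "\<dots> = (\<Sum>i = 1..m. mat_trace (V i * mat_adjoint (V i)))"
    using carr by (intro sum.cong refl mat_trace_commute[of _ d l]) auto
  also have "\<dots> = (\<Sum>i = 1..m. of_real (real l * w))"
    using VV by (intro sum.cong refl) (auto simp: mat_trace_def)
  also have "\<dots> = of_real (real m * (real l * w))" by simp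
  finally have "real d = real m * (real l * w)" by (simp only: of_real_eq_iff)
  then have "w = real d / (real m * real l)" using ml by (simp add: field_simps)
  with VV[OF i] show "V i * mat_adjoint (V i) = of_real (real d / (real m * real l)) \<cdot>\<^sub>m 1\<^sub>m l" by simp
qed

section \<open>Error operators for two lost packets\<close>

text \<open>\<open>packet_lost\<close> is the diagonal projection onto the surviving packets, so the
  difference keeps only the rows of \<open>W\<close> in the two lost blocks.\<close>

lemma lost_packets_error:
  fixes V :: "nat \<Rightarrow> 'a::real_or_complex mat"
  assumes V: "\<And>i. i \<in> {1..m} \<Longrightarrow> V i \<in> carrier_mat l d"
    and ij: "i \<in> {1..m}" "j \<in> {1..m}" "i \<noteq> j"
  defines "W \<equiv> analysis_op m l d V"
  shows "mat_adjoint W * W - mat_adjoint W * packet_lost m l {i, j} * W =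
    mat_adjoint (V i) * V i + mat_adjoint (V j) * V j"
proof (rule eq_matI)
  have W: "W \<in> carrier_mat (m * l) d" by (simp add: W_def analysis_op_def)
  define E :: "'a mat" where "E = packet_lost m l {i, j}"
  have E: "E \<in> carrier_mat (m * l) (m * l)" by (simp add: E_def packet_lost_def)
  have Vi: "V i \<in> carrier_mat l d" "V j \<in> carrier_mat l d" using V ij by auto
  fix r c assume "r < dim_row (mat_adjoint (V i) * V i + mat_adjoint (V j) * V j)"
    "c < dim_col (mat_adjoint (V i) * V i + mat_adjoint (V j) * V j)"
  then have rc: "r < d" "c < d" using Vi by auto
  define f where "f x = conjugate (W $$ (x, r)) * W $$ (x, c)" for x
  define h where "h k = (\<Sum>y<l. conjugate (V k $$ (y, r)) * V k $$ (y, c))" for k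
  have h: "(mat_adjoint (V k) * V k) $$ (r, c) = h k" if "k \<in> {1..m}" for k
    using V[OF that] rc by (simp add: h_def scalar_prod_def lessThan_atLeast0)
  have EW: "(E * W) $$ (x, c) = (if Suc (x div l) \<in> {i, j} then 0 else W $$ (x, c))" if x: "x < m * l" for x
  proof (cases "Suc (x div l) \<in> {i, j}")
    case True
    then show ?thesis using x rc W by (auto simp: scalar_prod_def E_def packet_lost_def)
  next
    case False
    then show ?thesis using x rc W
      by (simp add: scalar_prod_def E_def packet_lost_def if_distrib[of "\<lambda>x. x * _"] cong: if_cong)
  qed
  have WEW: "mat_adjoint W * E * W = mat_adjoint W * (E * W)"
    using W E by (intro assoc_mult_mat[of _ d "m * l" _ "m * l"]) auto
  have "(mat_adjoint W * W - mat_adjoint W * E * W) $$ (r, c) =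
      (\<Sum>x<m * l. conjugate (W $$ (x, r)) * W $$ (x, c)) - (\<Sum>x<m * l. conjugate (W $$ (x, r)) * (E * W) $$ (x, c))"
    using W E rc unfolding WEW by (simp add: scalar_prod_def[of "row (mat_adjoint W) r"] lessThan_atLeast0 del: assoc_mult_mat)
  also have "\<dots> = (\<Sum>x<m * l. if Suc (x div l) \<in> {i, j} then f x else 0)"
    unfolding sum_subtractf[symmetric] by (rule sum.cong) (auto simp: EW f_def)
  \<comment> \<open>Rows are grouped by packet: x = k * l + y with y < l belongs to packet
    \<open>Suc k\<close>, since packets are numbered from 1 and rows from 0.\<close>
  also have "\<dots> = (\<Sum>k<m. \<Sum>x = k * l..<k * l + l. if Suc (x div l) \<in> {i, j} then f x else 0)"
    by (rule sum.nat_group[symmetric])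
  also have "\<dots> = (\<Sum>k<m. if Suc k \<in> {i, j} then h (Suc k) else 0)"
  proof (rule sum.cong)
    fix k assume k: "k \<in> {..<m}"
    have "(\<Sum>x = k * l..<k * l + l. if Suc (x div l) \<in> {i, j} then f x else 0) =
      (\<Sum>y = 0..<l. if Suc ((y + k * l) div l) \<in> {i, j} then f (y + k * l) else 0)"
      using sum.shift_bounds_nat_ivl[of "\<lambda>x. if Suc (x div l) \<in> {i, j} then f x else 0" 0 "k * l" l]
      by (simp only: add_0 add.commute[of l "k * l"])
    also have "\<dots> = (\<Sum>y = 0..<l. if Suc k \<in> {i, j} then conjugate (V (Suc k) $$ (y, r)) * V (Suc k) $$ (y, c) else 0)"
    proof (rule sum.cong)
      fix y assume "y \<in> {0..<l}"
      then have y: "y < l" by simp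
      then have "(y + k * l) div l = k" "(y + k * l) mod l = y" by auto
      moreover have "y + k * l < m * l"
      proof -
        have "Suc k * l \<le> m * l" using k by (intro mult_le_mono1) auto
        with y show ?thesis by simp
      qed
      ultimately show "(if Suc ((y + k * l) div l) \<in> {i, j} then f (y + k * l) else 0) =
        (if Suc k \<in> {i, j} then conjugate (V (Suc k) $$ (y, r)) * V (Suc k) $$ (y, c) else 0)"
        using rc by (simp add: f_def W_def analysis_op_def)
    qed simp
    finally show "(\<Sum>x = k * l..<k * l + l. if Suc (x div l) \<in> {i, j} then f x else 0) =
        (if Suc k \<in> {i, j} then h (Suc k) else 0)"
      by (simp add: h_def lessThan_atLeast0)
  qed simp
  also have "\<dots> = (\<Sum>k = 1..m. if k \<in> {i, j} then h k else 0)"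
    by (rule sum.reindex_bij_witness[of _ "\<lambda>k. k - 1" Suc]) auto
  also have "\<dots> = (\<Sum>k \<in> {1..m} \<inter> {i, j}. h k)" by (simp add: sum.inter_restrict)
  also have "{1..m} \<inter> {i, j} = {i, j}" using ij by auto
  also have "(\<Sum>k \<in> {i, j}. h k) = h i + h j" using ij by simp
  also have "\<dots> = (mat_adjoint (V i) * V i + mat_adjoint (V j) * V j) $$ (r, c)"
    using Vi rc ij by (simp add: h[symmetric])
  finally show "(mat_adjoint W * W - mat_adjoint W * packet_lost m l {i, j} * W) $$ (r, c) =
    (mat_adjoint (V i) * V i + mat_adjoint (V j) * V j) $$ (r, c)" by (simp only: E_def)
qed (use V[OF ij(1)] V[OF ij(2)] in \<open>auto simp: W_def analysis_op_def\<close>)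

text \<open>Two-element sets are replaced by ordered pairs, so that the maximum runs over the same
  index set as the one in \<open>protocol_class\<close>.\<close>

lemma worst_error_two:
  fixes V :: "nat \<Rightarrow> 'a::real_or_complex mat" and N :: "nat \<Rightarrow> 'a mat \<Rightarrow> real"
  assumes V: "\<And>i. i \<in> {1..m} \<Longrightarrow> V i \<in> carrier_mat l d"
  defines "err \<equiv> \<lambda>i j. N d (mat_adjoint (V i) * V i + mat_adjoint (V j) * V j)"
  shows "worst_error N 2 m l d (analysis_op m l d V) =
    Max {err i j | i j. i \<in> {1..m} \<and> j \<in> {1..m} \<and> i \<noteq> j}"
proof -
  let ?W = "analysis_op m l d V"
  have err: "N d (mat_adjoint ?W * ?W - mat_adjoint ?W * packet_lost m l {i, j} * ?W) = err i j"
    if "i \<in> {1..m}" "j \<in> {1..m}" "i \<noteq> j" for i j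
    unfolding err_def by (subst lost_packets_error[OF V that]) auto
  have "{N d (mat_adjoint ?W * ?W - mat_adjoint ?W * packet_lost m l K * ?W) | K.
      K \<subseteq> {1..m} \<and> card K = 2} = {err i j | i j. i \<in> {1..m} \<and> j \<in> {1..m} \<and> i \<noteq> j}"
  proof (intro equalityI subsetI)
    fix x assume "x \<in> {N d (mat_adjoint ?W * ?W - mat_adjoint ?W * packet_lost m l K * ?W) | K.
      K \<subseteq> {1..m} \<and> card K = 2}"
    then obtain K where K: "K \<subseteq> {1..m}" "card K = 2"
      and x: "x = N d (mat_adjoint ?W * ?W - mat_adjoint ?W * packet_lost m l K * ?W)" by blast
    then obtain i j where "K = {i, j}" "i \<noteq> j" by (auto simp: card_2_iff)
    with K x err[of i j] show "x \<in> {err i j | i j. i \<in> {1..m} \<and> j \<in> {1..m} \<and> i \<noteq> j}" by blast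
  next
    fix x assume "x \<in> {err i j | i j. i \<in> {1..m} \<and> j \<in> {1..m} \<and> i \<noteq> j}"
    then obtain i j where ij: "i \<in> {1..m}" "j \<in> {1..m}" "i \<noteq> j" "x = err i j" by blast
    then have "x = N d (mat_adjoint ?W * ?W - mat_adjoint ?W * packet_lost m l {i, j} * ?W)"
      using err by simp
    moreover have "{i, j} \<subseteq> {1..m}" "card {i, j} = 2" using ij by auto
    ultimately show "x \<in> {N d (mat_adjoint ?W * ?W - mat_adjoint ?W * packet_lost m l K * ?W) | K.
      K \<subseteq> {1..m} \<and> card K = 2}" by blast
  qed
  then show ?thesis by (simp only: worst_error_def)
qed

lemma finite_pairs: "finite {f i j | i j. i \<in> {1..m::nat} \<and> j \<in> {1..m::nat} \<and> i \<noteq> j}"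
  by (rule finite_subset[of _ "(\<lambda>(i, j). f i j) ` ({1..m} \<times> {1..m})"]) auto

lemma pairs_const:
  fixes m :: nat
  assumes "m \<ge> 2" and f: "\<And>i j. i \<in> {1..m} \<Longrightarrow> j \<in> {1..m} \<Longrightarrow> i \<noteq> j \<Longrightarrow> f i j = x"
  shows "{f i j | i j. i \<in> {1..m} \<and> j \<in> {1..m} \<and> i \<noteq> j} = {x}"
proof -
  have "1 \<in> {1..m}" "2 \<in> {1..m}" "(1::nat) \<noteq> 2" using assms(1) by auto
  moreover from f[OF this] have "f 1 2 = x" .
  ultimately show ?thesis using f by blast
qed

section \<open>The bound and the case of equality\<close>

text \<open>Here A^* A = c^2 I, so every singular value is c. The first conclusion yields membership
  in the class, the second the exact error spectrum w + c, w - c.\<close>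

lemma trace_abs_scaled_unitary:
  fixes A :: "'a::real_or_complex mat"
  assumes Q: "unitary_mat l Q" and A: "A = of_real c \<cdot>\<^sub>m Q" and c: "0 \<le> c"
  shows "trace_abs A = real l * c"
    and "char_poly (mat_adjoint A * A) = (\<Prod>i<l. [:- of_real (c\<^sup>2), 1:])"
proof -
  note Qc = unitary_matD[OF Q]
  have Ac: "A \<in> carrier_mat l l" using Qc by (simp add: A)
  have "mat_adjoint A * A = of_real c \<cdot>\<^sub>m (of_real c \<cdot>\<^sub>m (mat_adjoint Q * Q))"
    using Qc(1,2) by (simp add: A mat_adjoint_smult mult_smult_distrib[of _ l l _ l] mult_smult_assoc_mat[of _ l l _ l])
  also have "\<dots> = real_diag l (\<lambda>_. c\<^sup>2)" unfolding Qc(3) by (intro eq_matI) (auto simp: power2_eq_square)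
  finally show cp: "char_poly (mat_adjoint A * A) = (\<Prod>i<l. [:- of_real (c\<^sup>2), 1:])"
    by (simp only: char_poly_real_diag)
  obtain \<sigma> where \<sigma>: "\<forall>i<l. 0 \<le> \<sigma> i" "trace_abs A = (\<Sum>i<l. \<sigma> i)"
    "char_poly (mat_adjoint A * A) = (\<Prod>i<l. [:- of_real ((\<sigma> i)\<^sup>2), 1:])"
    using trace_abs_eigenvalues[OF Ac] by blast
  have "(\<Prod>i<l. [:- of_real ((\<sigma> i)\<^sup>2), 1:]) = (\<Prod>i<l. [:- of_real (c\<^sup>2), 1 :: 'a:])"
    using cp \<sigma>(3) by simp
  from prod_linear_factors_permutes[OF this] have "(\<sigma> i)\<^sup>2 = c\<^sup>2" if "i < l" for i
    using that by (auto simp only: of_real_eq_iff)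
  then have "\<sigma> i = c" if "i < l" for i using that \<sigma>(1) c by (simp add: power2_eq_iff_nonneg)
  then show "trace_abs A = real l * c" by (simp add: \<sigma>(2))
qed

theorem theorem4p3:
  fixes m l d :: nat
    and N :: "nat \<Rightarrow> 'a::real_or_complex mat \<Rightarrow> real"
    and \<psi> :: "nat \<Rightarrow> real vec \<Rightarrow> real"
  assumes "l < d" and "d < m * l"
    and "compatible_ui_norm N"
    and "associated_gauge N \<psi>"
  shows
    "(\<forall>V \<in> protocol_class m l d.
        worst_error N 2 m l d (analysis_op m l d V) \<ge>
          \<psi> (l + l) ((real d / (real m * real l) + c_const m l d) \<cdot>\<^sub>v vec l (\<lambda>_. 1) @\<^sub>v
                   (real d / (real m * real l) - c_const m l d) \<cdot>\<^sub>v vec l (\<lambda>_. 1))) \<and>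
     (\<forall>V. uwp_rank_protocol m l d V \<and>
        (\<forall>i \<in> {1..m}. \<forall>j \<in> {1..m}. i \<noteq> j \<longrightarrow>
           (\<exists>Q. unitary_mat l Q \<and> V i * mat_adjoint (V j) = of_real (c_const m l d) \<cdot>\<^sub>m Q)) \<longrightarrow>
        V \<in> protocol_class m l d \<and>
        worst_error N 2 m l d (analysis_op m l d V) =
          \<psi> (l + l) ((real d / (real m * real l) + c_const m l d) \<cdot>\<^sub>v vec l (\<lambda>_. 1) @\<^sub>v
                   (real d / (real m * real l) - c_const m l d) \<cdot>\<^sub>v vec l (\<lambda>_. 1)))"
proof -
  define w where "w = real d / (real m * real l)"
  define c where "c = c_const m l d"
  define \<Psi> where "\<Psi> = \<psi> (l + l) (vec (l + l) (\<lambda>i. if i < l then w + c else w - c))"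
  have l: "l > 0" and d: "d > 0" and ml: "m * l > 0" using assms(1,2) by (auto intro: Nat.gr0I)
  \<comment> \<open>Two packets are needed for the maxima over pairs i \<noteq> j to range over
    nonempty sets, and for m - 1 in \<open>c_const\<close> to be positive.\<close>
  have m: "m \<ge> 2"
  proof (rule ccontr)
    assume "\<not> m \<ge> 2"
    then have "m * l \<le> 1 * l" by (intro mult_le_mono1) auto
    with assms(1,2) show False by simp
  qed
  have target: "\<psi> (l + l) ((w + c) \<cdot>\<^sub>v vec l (\<lambda>_. 1) @\<^sub>v (w - c) \<cdot>\<^sub>v vec l (\<lambda>_. 1)) = \<Psi>"
    unfolding \<Psi>_def by (rule arg_cong[of _ _ "\<psi> (l + l)"]) (intro eq_vecI, auto)
  \<comment> \<open>The real \<open>sqrt\<close> is an odd function, negative on negative arguments,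
    so the sign of the radicand has to be checked; it comes from d < m l.\<close>
  have c0: "0 \<le> c"
  proof -
    have "real d \<le> real m * real l" using assms(2) by (metis less_imp_le of_nat_le_iff of_nat_mult)
    then have "real d / (real m * real l) \<le> 1" using ml by (intro divide_le_eq_1_pos[THEN iffD2]) (simp_all add: zero_less_mult_iff)
    then show ?thesis using m by (simp add: c_def c_const_def)
  qed
  have g: "symmetric_gauge (l + l) (\<psi> (l + l))" using assms(4) l by (simp add: associated_gauge_def)
  define err where "err V i j = N d (mat_adjoint (V i) * V i + mat_adjoint (V j) * V j)"
    for V :: "nat \<Rightarrow> 'a mat" and i j
  have err: "err V i j = \<psi> (l + l) (vec (l + l) (\<lambda>i. if i < l then w + \<sigma> i else w - \<sigma> (i - l)))"
    if "uwp_rank_protocol m l d V" "i \<in> {1..m}" "j \<in> {1..m}"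
      "char_poly (mat_adjoint (V i * mat_adjoint (V j)) * (V i * mat_adjoint (V j))) =
         (\<Prod>i<l. [:- of_real ((\<sigma> i)\<^sup>2), 1:])" for V i j \<sigma>
    unfolding err_def using that uwp_rank_protocol_coisometry[OF that(1) ml]
    by (intro norm_gram_sum[OF assms(3,4) l d]) (auto simp: w_def)
  have worst: "worst_error N 2 m l d (analysis_op m l d V) =
      Max {err V i j | i j. i \<in> {1..m} \<and> j \<in> {1..m} \<and> i \<noteq> j}" if "uwp_rank_protocol m l d V" for V
    unfolding err_def using uwp_rank_protocol_coisometry(1)[OF that ml] by (rule worst_error_two)
  have one_two: "1 \<in> {1..m}" "2 \<in> {1..m}" "(1::nat) \<noteq> 2" using m by auto
  have "\<Psi> \<le> worst_error N 2 m l d (analysis_op m l d V)" if V: "V \<in> protocol_class m l d" for V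
  proof -
    let ?T = "{trace_abs (V i * mat_adjoint (V j)) | i j. i \<in> {1..m} \<and> j \<in> {1..m} \<and> i \<noteq> j}"
    have uwp: "uwp_rank_protocol m l d V" and T: "real l * c \<le> Max ?T"
      using V by (auto simp: protocol_class_def c_def)
    \<comment> \<open>A pair attaining the maximal trace norm already loses enough: its error alone
      is at least \<Psi>, and the worst error dominates it.\<close>
    have "Max ?T \<in> ?T" using one_two by (intro Max_in finite_pairs) blast
    then obtain i j where ij: "i \<in> {1..m}" "j \<in> {1..m}" "i \<noteq> j"
      and tr: "real l * c \<le> trace_abs (V i * mat_adjoint (V j))"
      using T by auto
    have A: "V i * mat_adjoint (V j) \<in> carrier_mat l l"
      using uwp_rank_protocol_coisometry(1)[OF uwp ml] ij by (intro mult_carrier_mat[of _ l d]) auto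
    obtain \<sigma> where \<sigma>: "trace_abs (V i * mat_adjoint (V j)) = (\<Sum>i<l. \<sigma> i)"
      "char_poly (mat_adjoint (V i * mat_adjoint (V j)) * (V i * mat_adjoint (V j))) =
         (\<Prod>i<l. [:- of_real ((\<sigma> i)\<^sup>2), 1:])"
      using trace_abs_eigenvalues[OF A] by blast
    have "\<Psi> \<le> err V i j"
      unfolding \<Psi>_def err[OF uwp ij(1,2) \<sigma>(2)]
      using symmetric_gauge_two_level_le[OF g l c0] tr \<sigma>(1) by simp
    also have "\<dots> \<le> worst_error N 2 m l d (analysis_op m l d V)"
      unfolding worst[OF uwp] using ij by (intro Max_ge finite_pairs) blast
    finally show ?thesis .
  qed
  moreover have "V \<in> protocol_class m l d \<and> worst_error N 2 m l d (analysis_op m l d V) = \<Psi>"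
    if uwp: "uwp_rank_protocol m l d V" and Q: "\<forall>i \<in> {1..m}. \<forall>j \<in> {1..m}. i \<noteq> j \<longrightarrow>
           (\<exists>Q. unitary_mat l Q \<and> V i * mat_adjoint (V j) = of_real c \<cdot>\<^sub>m Q)" for V
  proof
    \<comment> \<open>All pairs behave alike, so both maxima are taken over singletons.\<close>
    have pair: "trace_abs (V i * mat_adjoint (V j)) = real l * c" "err V i j = \<Psi>"
      if ij: "i \<in> {1..m}" "j \<in> {1..m}" "i \<noteq> j" for i j
    proof -
      obtain Q where Q: "unitary_mat l Q" "V i * mat_adjoint (V j) = of_real c \<cdot>\<^sub>m Q"
        using Q ij by blast
      show "trace_abs (V i * mat_adjoint (V j)) = real l * c"
        by (rule trace_abs_scaled_unitary(1)[OF Q c0])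
      show "err V i j = \<Psi>"
        using err[OF uwp ij(1,2) trace_abs_scaled_unitary(2)[OF Q c0]] by (simp only: \<Psi>_def)
    qed
    have "{trace_abs (V i * mat_adjoint (V j)) | i j. i \<in> {1..m} \<and> j \<in> {1..m} \<and> i \<noteq> j} = {real l * c}"
      using m pair(1) by (rule pairs_const)
    then show "V \<in> protocol_class m l d" using uwp by (simp add: protocol_class_def c_def)
    have "{err V i j | i j. i \<in> {1..m} \<and> j \<in> {1..m} \<and> i \<noteq> j} = {\<Psi>}"
      using m pair(2) by (rule pairs_const)
    then show "worst_error N 2 m l d (analysis_op m l d V) = \<Psi>" by (simp add: worst[OF uwp])
  qed
  ultimately show ?thesis
    unfolding w_def[symmetric] c_def[symmetric] target by blast
qed

end
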